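(* Let $G = F,\ s\bowtie t$ be an AC typed forest (with cut), where $s$ is a nontrivial expansion. Let $s=s_1+s_2$ (that is, the nonempty expansions $s_1$ and $s_2$ partition the summands of $s$), and let $w_1,\dots,w_k,c_1,\dots,c_m,t$ be (the roots of) a subnet of $G$ whose roots other than $t$ are all either witnesses (the $w_i$) or cuts (the $c_i$). Let $F'$ be the forest obtained from $F$ by replacing each $w_i$ by $(w_i^L+w_i^R)$ and each $c_i$ by the two cuts $c_i^L,c_i^R$. Then $$G' = F',\ s_1\bowtie t^L,\ s_2\bowtie t^R$$ is an AC typed forest (with cut), and the type of $G'$ is a closure of the type of $G$.
   Context: **Formulae.** $A ::= a \mid \bar a \mid \top \mid \bot \mid A\land A \mid A\lor A$ ($a$ a proposition symbol); $\bar A$ is the De Morgan dual of $A$. **Expansion trees.** Wire variables come in dual pairs $x,\bar x$. Expansion trees $t$ and witnesses $w$: $t ::= 1 \mid (w+\dots+w) \mid (t\lor t)\mid (t\lor * )\mid ( *\lor t)$, $w ::= x\mid \bar x\mid t\otimes t$, where $(w_1+\dots+w_n)$ is a nonempty finite formal (unordered) sum, called an expansion (nontrivial if $n\ge2$). **Types.** A type is a formula or a witness type $[a]$, $[\bar a]$, $A\otimes B$, whose underlying formulae are $a$, $\bar a$, $A\land B$. Typing: $x:[p]$, $\bar x:[\bar p]$; $1:\top$; $(t\lor * ):A\lor B$ if $t:A$; $( *\lor t):A\lor B$ if $t:B$; $(t\lor s):A\lor B$ and $t\otimes s:A\otimes B$ if $t:A,s:B$; $(w_1+\dots+w_n)$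 has type $p$, $\bar p$, $A\land B$ if all $w_i$ have type $[p]$, $[\bar p]$, $A\otimes B$ respectively. **Cuts.** A cut tree $t\bowtie s$ is an unordered pair of expansion trees $t:A$, $s:\bar A$ with $A\neq\top,\bot$; its positive term is the one of type $\bar a$ or $A\land B$, by convention written on the left. A typed forest with cut is a finite collection of typed expansion trees, typed witnesses and cut trees in which each wire variable occurs at most once and $x$ occurs iff $\bar x$ occurs; its type is the collection of types of its roots that are not cuts. **Copies.** $(\cdot)^L,(\cdot)^R$ denote two copies of a term in which each wire variable $x$ (resp. $\bar x$) is replaced by fresh ones $x^L,x^R$ (resp. $\bar x^L,\bar x^R$), with $x^L$ dual to $\bar x^L$ and $x^R$ dual to $\bar x^R$. When a witness $w_i$ that is a summand of an expansion is replaced by $(w_i^L+w_i^R)$, sums are flattened; if $w_i$ is a root, that root is replaced by the expansion $(w_i^L+w_i^R)$. **Closure.** A closure of a forest of types $\Gamma$ is a forest of types $\Gamma'$ together with an injective function $f$ from the members of $\Gamma'$ to those of $\Gamma$ such that each member $r$ of $\Gamma'$ is either equal to $f(r)$ or is the underlying formula of the witness type $f(r)$. **AC-correctness.** View a typed forest with cut as a forest of nodes (subterm occurrences, including occurrences of $*$), where a cut $t\bowtie s$ is a root node with successors $t,s$; $(t\lor * )$ has successors $t$ and $*$; an expansion has its summands as successors; wire variables, $1$ and $*$ are leaves. Its graph has an edge from each node to its predecessor and an edge between $x$ and $\bar x$ for each wire variable. Switched nodes are expansions and nodes $t\lor s$ with neither $t$ nor $s$ equal to $*$; all other nodes are unswitched.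 A switching chooses one successor of each switched node; its switching graph is obtained from the graph by deleting all edges from the non-chosen successors of switched nodes to those nodes and forgetting directions. The forest is AC (AC-correct) if every switching graph is acyclic. A switching path is a path in some switching graph. **Subnets.** A substructure is a nonempty set of nodes closed under taking successors, closed under axiom links (if it contains a wire variable occurrence it contains its dual), and such that if it contains an occurrence of $*$ it contains the predecessor of that occurrence; its roots are its nodes with no predecessor in it. A subnet of an AC forest is a substructure $H$ such that for any two roots of $H$ every switching path between them lies inside $H$. *)

theory Defs
  imports "HOL-Library.Multiset"
begin

datatype 'a form =
  Atom 'a | NegAtom 'a | Top | Bot | Conj "'a form" "'a form" | Disj "'a form" "'a form"

primrec dual :: "'a form \<Rightarrow> 'a form" where
  "dual (Atom a) = NegAtom a"
| "dual (NegAtom a) = Atom a"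
| "dual Top = Bot"
| "dual Bot = Top"
| "dual (Conj A B) = Disj (dual A) (dual B)"
| "dual (Disj A B) = Conj (dual A) (dual B)"

datatype 'a wtype = WAtom 'a | WNegAtom 'a | WTensor "'a form" "'a form"

primrec underlying :: "'a wtype \<Rightarrow> 'a form" where
  "underlying (WAtom a) = Atom a"
| "underlying (WNegAtom a) = NegAtom a"
| "underlying (WTensor A B) = Conj A B"

datatype 'a type = FormT "'a form" | WitT "'a wtype"

text \<open>
  The wire variables \<open>x\<close> and \<open>\<bar>x\<close> are \<open>Wire x\<close> and \<open>DWire x\<close>; hence a renaming of names
  respects duality. \<open>OrL t\<close> is \<open>(t \<or> *)\<close> and \<open>OrR t\<close> is \<open>(* \<or> t)\<close>.

  Formal sums and forests are represented by lists: equal summands are distinct occurrences, and an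
  occurrence is named by its index. All notions below are insensitive to the order of the lists,
  and sums are decomposed only up to reordering (via \<open>mset\<close>). Nonemptiness of sums is imposed by
  the typing rule for expansions.
\<close>

datatype 'v tree =
  One | Expansion "'v wit list" | Or "'v tree" "'v tree" | OrL "'v tree" | OrR "'v tree"
and 'v wit =
  Wire 'v | DWire 'v | Tensor "'v tree" "'v tree"

text \<open>
  The parameter \<open>\<tau>\<close> gives the proposition symbol \<open>p\<close> of each wire variable, so that the two members
  of a dual pair receive the dual types \<open>[p]\<close> and \<open>[\<bar>p]\<close>.
\<close>

inductive typed_tree :: "('v \<Rightarrow> 'a) \<Rightarrow> 'v tree \<Rightarrow> 'a form \<Rightarrow> bool"
  and typed_wit :: "('v \<Rightarrow> 'a) \<Rightarrow> 'v wit \<Rightarrow> 'a wtype \<Rightarrow> bool"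
  for \<tau> :: "'v \<Rightarrow> 'a"
where
  "typed_tree \<tau> One Top"
| "ws \<noteq> [] \<Longrightarrow> (\<And>w. w \<in> set ws \<Longrightarrow> typed_wit \<tau> w P) \<Longrightarrow> typed_tree \<tau> (Expansion ws) (underlying P)"
| "typed_tree \<tau> t A \<Longrightarrow> typed_tree \<tau> s B \<Longrightarrow> typed_tree \<tau> (Or t s) (Disj A B)"
| "typed_tree \<tau> t A \<Longrightarrow> typed_tree \<tau> (OrL t) (Disj A B)"
| "typed_tree \<tau> t B \<Longrightarrow> typed_tree \<tau> (OrR t) (Disj A B)"
| "typed_wit \<tau> (Wire x) (WAtom (\<tau> x))"
| "typed_wit \<tau> (DWire x) (WNegAtom (\<tau> x))"
| "typed_tree \<tau> t A \<Longrightarrow> typed_tree \<tau> s B \<Longrightarrow> typed_wit \<tau> (Tensor t s) (WTensor A B)"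

text \<open>
  Members of a forest with cut; trees and witnesses carry their type, since \<open>(t \<or> *)\<close> does not
  determine it. A cut is an unordered pair: both \<open>Cut t s\<close> and \<open>Cut s t\<close> represent it, and the
  convention of writing the positive term on the left is not imposed.
\<close>

datatype ('v, 'a) member =
  TreeRoot "'v tree" "'a form" | WitRoot "'v wit" "'a wtype" | Cut "'v tree" "'v tree"

type_synonym ('v, 'a) forest = "('v, 'a) member list"

primrec typed_member :: "('v \<Rightarrow> 'a) \<Rightarrow> ('v, 'a) member \<Rightarrow> bool" where
  "typed_member \<tau> (TreeRoot t A) \<longleftrightarrow> typed_tree \<tau> t A"
| "typed_member \<tau> (WitRoot w P) \<longleftrightarrow> typed_wit \<tau> w P"
| "typed_member \<tau> (Cut t s) \<longleftrightarrow>
    (\<exists>A. A \<noteq> Top \<and> A \<noteq> Bot \<and> typed_tree \<tau> t A \<and> typed_tree \<tau> s (dual A))"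

primrec member_type :: "('v, 'a) member \<Rightarrow> 'a type list" where
  "member_type (TreeRoot t A) = [FormT A]"
| "member_type (WitRoot w P) = [WitT P]"
| "member_type (Cut t s) = []"

definition forest_type :: "('v, 'a) forest \<Rightarrow> 'a type list" where
  "forest_type G = concat (map member_type G)"

definition is_closure :: "'a type list \<Rightarrow> 'a type list \<Rightarrow> bool" where
  "is_closure \<Gamma>' \<Gamma> \<longleftrightarrow>
    (\<exists>f. inj_on f {..<length \<Gamma>'} \<and> f ` {..<length \<Gamma>'} \<subseteq> {..<length \<Gamma>} \<and>
      (\<forall>i<length \<Gamma>'. \<Gamma>' ! i = \<Gamma> ! f i \<or>
        (\<exists>P. \<Gamma> ! f i = WitT P \<and> \<Gamma>' ! i = FormT (underlying P))))"

text \<open>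
  A node is addressed by a position: the index of its root in the forest followed by the indices of
  the successors leading to it. \<open>node_at\<close> returns the subterm occurring there. In particular
  \<open>[]\<close> is not a position of a node, and the components of the cut with index \<open>i\<close> are at
  \<open>[i, 0]\<close> and \<open>[i, 1]\<close>.
\<close>

datatype 'v node = NTree "'v tree" | NWit "'v wit" | NStar | NCut "'v tree" "'v tree"

fun successors :: "'v node \<Rightarrow> 'v node list" where
  "successors (NTree One) = []"
| "successors (NTree (Expansion ws)) = map NWit ws"
| "successors (NTree (Or t s)) = [NTree t, NTree s]"
| "successors (NTree (OrL t)) = [NTree t, NStar]"
| "successors (NTree (OrR t)) = [NStar, NTree t]"
| "successors (NWit (Wire x)) = []"
| "successors (NWit (DWire x)) = []"
| "successors (NWit (Tensor t s)) = [NTree t, NTree s]"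
| "successors NStar = []"
| "successors (NCut t s) = [NTree t, NTree s]"

primrec root_node :: "('v, 'a) member \<Rightarrow> 'v node" where
  "root_node (TreeRoot t A) = NTree t"
| "root_node (WitRoot w P) = NWit w"
| "root_node (Cut t s) = NCut t s"

type_synonym position = "nat list"

primrec node_in :: "'v node list \<Rightarrow> position \<Rightarrow> 'v node option" where
  "node_in ns [] = None"
| "node_in ns (i # p) =
    (if i < length ns then if p = [] then Some (ns ! i) else node_in (successors (ns ! i)) p
     else None)"

definition node_at :: "('v, 'a) forest \<Rightarrow> position \<Rightarrow> 'v node option" where
  "node_at G p = node_in (map root_node G) p"

definition nodes :: "('v, 'a) forest \<Rightarrow> position set" where
  "nodes G = {p. node_at G p \<noteq> None}"

definition wires_in :: "('v, 'a) forest \<Rightarrow> position set \<Rightarrow> 'v set" where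
  "wires_in G H =
    {x. \<exists>p\<in>H. node_at G p = Some (NWit (Wire x)) \<or> node_at G p = Some (NWit (DWire x))}"

definition typed_forest :: "('v, 'a) forest \<Rightarrow> bool" where
  "typed_forest G \<longleftrightarrow>
    (\<exists>\<tau>. \<forall>m\<in>set G. typed_member \<tau> m) \<and>
    (\<forall>x p q. node_at G p = Some (NWit (Wire x)) \<and> node_at G q = Some (NWit (Wire x)) \<longrightarrow> p = q) \<and>
    (\<forall>x p q. node_at G p = Some (NWit (DWire x)) \<and> node_at G q = Some (NWit (DWire x)) \<longrightarrow> p = q) \<and>
    (\<forall>x. (\<exists>p. node_at G p = Some (NWit (Wire x))) \<longleftrightarrow> (\<exists>p. node_at G p = Some (NWit (DWire x))))"

definition is_successor :: "('v, 'a) forest \<Rightarrow> position \<Rightarrow> position \<Rightarrow> bool" where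
  "is_successor G p q \<longleftrightarrow> p \<in> nodes G \<and> q \<in> nodes G \<and> (\<exists>i. q = p @ [i])"

definition axiom_link :: "('v, 'a) forest \<Rightarrow> position \<Rightarrow> position \<Rightarrow> bool" where
  "axiom_link G p q \<longleftrightarrow>
    (\<exists>x. node_at G p = Some (NWit (Wire x)) \<and> node_at G q = Some (NWit (DWire x)))"

definition switched :: "('v, 'a) forest \<Rightarrow> position \<Rightarrow> bool" where
  "switched G p \<longleftrightarrow>
    (\<exists>ws. node_at G p = Some (NTree (Expansion ws))) \<or> (\<exists>t s. node_at G p = Some (NTree (Or t s)))"

definition is_switching :: "('v, 'a) forest \<Rightarrow> (position \<Rightarrow> position) \<Rightarrow> bool" where
  "is_switching G \<sigma> \<longleftrightarrow> (\<forall>p. switched G p \<longrightarrow> is_successor G p (\<sigma> p))"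

definition kept_edge ::
  "('v, 'a) forest \<Rightarrow> (position \<Rightarrow> position) \<Rightarrow> position \<Rightarrow> position \<Rightarrow> bool" where
  "kept_edge G \<sigma> q p \<longleftrightarrow> is_successor G p q \<and> (switched G p \<longrightarrow> q = \<sigma> p)"

text \<open>
  Adjacency in the switching graph. Wire nodes have no successors, so the graph has neither loops
  nor parallel edges, and its cycles have at least three nodes.
\<close>

definition switching_adj ::
  "('v, 'a) forest \<Rightarrow> (position \<Rightarrow> position) \<Rightarrow> position \<Rightarrow> position \<Rightarrow> bool" where
  "switching_adj G \<sigma> p q \<longleftrightarrow>
    kept_edge G \<sigma> p q \<or> kept_edge G \<sigma> q p \<or> axiom_link G p q \<or> axiom_link G q p"

definition switching_path :: "('v, 'a) forest \<Rightarrow> position list \<Rightarrow> bool" where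
  "switching_path G ps \<longleftrightarrow> ps \<noteq> [] \<and> set ps \<subseteq> nodes G \<and> distinct ps \<and>
    (\<exists>\<sigma>. is_switching G \<sigma> \<and> successively (switching_adj G \<sigma>) ps)"

definition switching_cycle ::
  "('v, 'a) forest \<Rightarrow> (position \<Rightarrow> position) \<Rightarrow> position list \<Rightarrow> bool" where
  "switching_cycle G \<sigma> ps \<longleftrightarrow> 3 \<le> length ps \<and> distinct ps \<and>
    successively (switching_adj G \<sigma>) ps \<and> switching_adj G \<sigma> (last ps) (hd ps)"

definition AC_correct :: "('v, 'a) forest \<Rightarrow> bool" where
  "AC_correct G \<longleftrightarrow> (\<forall>\<sigma>. is_switching G \<sigma> \<longrightarrow> \<not> (\<exists>ps. switching_cycle G \<sigma> ps))"

definition substructure :: "('v, 'a) forest \<Rightarrow> position set \<Rightarrow> bool" where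
  "substructure G H \<longleftrightarrow> H \<noteq> {} \<and> H \<subseteq> nodes G \<and>
    (\<forall>p q. p \<in> H \<and> is_successor G p q \<longrightarrow> q \<in> H) \<and>
    (\<forall>p q. axiom_link G p q \<longrightarrow> (p \<in> H \<longleftrightarrow> q \<in> H)) \<and>
    (\<forall>p q. q \<in> H \<and> node_at G q = Some NStar \<and> is_successor G p q \<longrightarrow> p \<in> H)"

definition roots :: "('v, 'a) forest \<Rightarrow> position set \<Rightarrow> position set" where
  "roots G H = {q \<in> H. \<not> (\<exists>p\<in>H. is_successor G p q)}"

definition subnet :: "('v, 'a) forest \<Rightarrow> position set \<Rightarrow> bool" where
  "subnet G H \<longleftrightarrow> substructure G H \<and>
    (\<forall>ps. switching_path G ps \<and> hd ps \<in> roots G H \<and> last ps \<in> roots G H \<longrightarrow> set ps \<subseteq> H)"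

text \<open>
  Copies of the wire variables in \<open>V\<close>, \<open>x\<^sup>L = l x\<close> and \<open>x\<^sup>R = r x\<close>, fresh with respect to \<open>U\<close>. The
  copies of a term are then its images under \<open>map_tree\<close> and \<open>map_wit\<close>.
\<close>

definition fresh_copies :: "('v \<Rightarrow> 'v) \<Rightarrow> ('v \<Rightarrow> 'v) \<Rightarrow> 'v set \<Rightarrow> 'v set \<Rightarrow> bool" where
  "fresh_copies l r V U \<longleftrightarrow>
    inj_on l V \<and> inj_on r V \<and> l ` V \<inter> r ` V = {} \<and> (l ` V \<union> r ` V) \<inter> U = {}"

text \<open>
  Duplication of the witnesses and cuts whose positions lie in \<open>D\<close>. The argument \<open>p\<close> is the position
  of the term being traversed; \<open>dup_sum l r D p i\<close> handles the summands, from index \<open>i\<close> on, of the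
  expansion at \<open>p\<close>.
\<close>

fun dup_tree :: "('v \<Rightarrow> 'v) \<Rightarrow> ('v \<Rightarrow> 'v) \<Rightarrow> position set \<Rightarrow> position \<Rightarrow> 'v tree \<Rightarrow> 'v tree"
  and dup_wit :: "('v \<Rightarrow> 'v) \<Rightarrow> ('v \<Rightarrow> 'v) \<Rightarrow> position set \<Rightarrow> position \<Rightarrow> 'v wit \<Rightarrow> 'v wit"
  and dup_sum :: "('v \<Rightarrow> 'v) \<Rightarrow> ('v \<Rightarrow> 'v) \<Rightarrow> position set \<Rightarrow> position \<Rightarrow> nat \<Rightarrow> 'v wit list \<Rightarrow> 'v wit list"
where
  "dup_tree l r D p One = One"
| "dup_tree l r D p (Expansion ws) = Expansion (dup_sum l r D p 0 ws)"
| "dup_tree l r D p (Or t s) = Or (dup_tree l r D (p @ [0]) t) (dup_tree l r D (p @ [1]) s)"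
| "dup_tree l r D p (OrL t) = OrL (dup_tree l r D (p @ [0]) t)"
| "dup_tree l r D p (OrR t) = OrR (dup_tree l r D (p @ [1]) t)"
| "dup_wit l r D p (Wire x) = Wire x"
| "dup_wit l r D p (DWire x) = DWire x"
| "dup_wit l r D p (Tensor t s) =
    Tensor (dup_tree l r D (p @ [0]) t) (dup_tree l r D (p @ [1]) s)"
| "dup_sum l r D p i [] = []"
| "dup_sum l r D p i (w # ws) =
    (if p @ [i] \<in> D then [map_wit l w, map_wit r w] else [dup_wit l r D (p @ [i]) w])
    @ dup_sum l r D p (Suc i) ws"

primrec dup_member ::
  "('v \<Rightarrow> 'v) \<Rightarrow> ('v \<Rightarrow> 'v) \<Rightarrow> position set \<Rightarrow> nat \<Rightarrow> ('v, 'a) member \<Rightarrow> ('v, 'a) forest" where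
  "dup_member l r D i (TreeRoot t A) = [TreeRoot (dup_tree l r D [i] t) A]"
| "dup_member l r D i (WitRoot w P) =
    (if [i] \<in> D then [TreeRoot (Expansion [map_wit l w, map_wit r w]) (underlying P)]
     else [WitRoot (dup_wit l r D [i] w) P])"
| "dup_member l r D i (Cut t s) =
    (if [i] \<in> D then [Cut (map_tree l t) (map_tree l s), Cut (map_tree r t) (map_tree r s)]
     else [Cut (dup_tree l r D [i, 0] t) (dup_tree l r D [i, 1] s)])"

definition dup_forest ::
  "('v \<Rightarrow> 'v) \<Rightarrow> ('v \<Rightarrow> 'v) \<Rightarrow> position set \<Rightarrow> ('v, 'a) forest \<Rightarrow> ('v, 'a) forest" where
  "dup_forest l r D F = concat (map2 (dup_member l r D) [0..<length F] F)"

end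

theory Submission
  imports Defs
begin

text \<open>
  Write \<open>H\<close> for the subnet. The reduced forest consists of two copies of \<open>H\<close>, two copies of the cut
  and of the expansion \<open>s\<close> on its positive side, between which the summands of \<open>s\<close> are divided, and one
  copy of everything else. Its nodes are therefore labelled by pairs of a tag (\<open>LCopy\<close>, \<open>RCopy\<close> or
  \<open>Kept\<close>) and a node of the given forest; the only other nodes are the expansions \<open>(w\<^sup>L + w\<^sup>R)\<close> that
  arise from witnesses \<open>w\<close> at a root (tag \<open>Added\<close>). The labelling is injective, and apart from the
  added expansions forgetting the tag preserves successors, switched nodes and axiom links. The
  linearity of the wire variables is read off from the labelling; typing and the closure property
  follow the recursive definition of duplication.

  AC-correctness is the substance. Let a switching graph of the reduced forest have a cycle. An added
  expansion has degree one in it and is not on the cycle. If the cycle does not visit two copies of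
  the same node, it projects to a cycle of a switching graph of the given forest (\<open>project_switching\<close>).
  Otherwise it visits a left copy and a right copy, and these two nodes cut it into two arcs. As no
  edge joins the left copies with the right copies, each arc contains a segment that leaves one copy
  of the doubled part, runs through kept nodes only, and enters the other copy. A copy is left either
  at a root \<open>w\<close> of \<open>H\<close>, towards the expansion of which \<open>w\<close> was a summand, or at \<open>s\<close>, towards one of the
  summands of \<open>s\<close>. If one end of the segment were a root \<open>w\<close>, then the projected segment, continued
  through the cut to \<open>t\<close> if the other end is \<open>s\<close>, would be a switching path between roots of \<open>H\<close> that
  leaves \<open>H\<close>, against the definition of a subnet (\<open>no_detour\<close>; the same root at both ends is excluded
  because an expansion keeps only one of its summands). So each arc contains the left copy of \<open>s\<close> and
  the summand that it keeps (\<open>crossing_arc\<close>). But the arcs share only their two end points, one a left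
  and the other a right copy, whereas the kept summand is neither.
\<close>

section \<open>Walks in a graph with ordered successors\<close>

text \<open>
  Following a position from an ordered family of starting points. With the function \<open>successors\<close> this is
  \<open>node_in\<close>; with a successor function on labels it assigns to each node of a forest its label.
\<close>

primrec walk :: "('x \<Rightarrow> 'x list) \<Rightarrow> 'x list \<Rightarrow> position \<Rightarrow> 'x option" where
  "walk ch xs [] = None"
| "walk ch xs (i # p) =
    (if i < length xs then if p = [] then Some (xs ! i) else walk ch (ch (xs ! i)) p else None)"

lemma node_in_eq_walk: "node_in ns p = walk successors ns p"
  by (induction p arbitrary: ns) auto

lemma walk_snoc:
  "p \<noteq> [] \<Longrightarrow> walk ch xs (p @ [i]) =
    (case walk ch xs p of None \<Rightarrow> None
     | Some x \<Rightarrow> if i < length (ch x) then Some (ch x ! i) else None)"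
proof (induction p arbitrary: xs)
  case (Cons j p)
  then show ?case by (cases p) auto
qed simp

lemma walk_closed:
  assumes "set xs \<subseteq> V" and "\<And>x. x \<in> V \<Longrightarrow> set (ch x) \<subseteq> V" and "walk ch xs p = Some x"
  shows "x \<in> V"
  using assms(1,3)
proof (induction p arbitrary: xs)
  case (Cons i p)
  then have i: "i < length xs" "xs ! i \<in> V"
    by (auto split: if_splits)
  show ?case
  proof (cases "p = []")
    case False
    then show ?thesis using Cons i assms(2)[OF i(2)] by auto
  qed (use Cons i in auto)
qed simp

text \<open>
  A function that is known on the starting points and compatible with successors describes what is
  found at all positions.
\<close>

lemma walk_map:
  assumes "set xs \<subseteq> V" and "\<And>x. x \<in> V \<Longrightarrow> set (ch x) \<subseteq> V"
    and "\<And>x. x \<in> V \<Longrightarrow> ch' (f x) = map f (ch x)"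
  shows "walk ch' (map f xs) p = map_option f (walk ch xs p)"
  using assms(1)
proof (induction p arbitrary: xs)
  case (Cons i p)
  show ?case
  proof (cases "i < length xs")
    case True
    then have "xs ! i \<in> V" using Cons.prems by auto
    then show ?thesis using True Cons.IH[OF assms(2)] assms(3) by auto
  qed simp
qed simp

text \<open>
  Read backwards, a walk is determined by its end: every point other than a start has exactly one
  predecessor and occurs once among the successors of that predecessor.
\<close>

lemma walk_inj:
  assumes "set xs \<subseteq> V" and "\<And>x. x \<in> V \<Longrightarrow> set (ch x) \<subseteq> V"
    and "distinct xs" and "\<And>x. x \<in> V \<Longrightarrow> distinct (ch x)"
    and "\<And>x. x \<in> V \<Longrightarrow> set (ch x) \<inter> set xs = {}"
    and "\<And>x y z. x \<in> V \<Longrightarrow> y \<in> V \<Longrightarrow> z \<in> set (ch x) \<Longrightarrow> z \<in> set (ch y) \<Longrightarrow> x = y"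
    and "walk ch xs p = Some z" and "walk ch xs q = Some z"
  shows "p = q"
  using assms(7,8)
proof (induction p arbitrary: q z rule: rev_induct)
  case (snoc i p)
  have q: "q \<noteq> []" using snoc.prems by auto
  define q' j where "q' = butlast q" and "j = last q"
  have qj: "q = q' @ [j]" using q by (simp add: q'_def j_def)
  have step: "(p = [] \<and> i < length xs \<and> z = xs ! i) \<or>
      (p \<noteq> [] \<and> (\<exists>x. walk ch xs p = Some x \<and> i < length (ch x) \<and> z = ch x ! i))"
    if "walk ch xs (p @ [i]) = Some z" for p i
    using that walk_snoc[of p ch xs i] by (cases "p = []") (auto split: if_splits option.splits)
  have c: "x \<in> V" if "walk ch xs p = Some x" for p x
    using walk_closed[OF assms(1,2) that] .
  from step[OF snoc.prems(1)] show ?case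
  proof (elim disjE conjE exE)
    assume p: "p = []" "i < length xs" "z = xs ! i"
    have z: "z \<in> set xs" using p by simp
    have "q' = []"
    proof (rule ccontr)
      assume "q' \<noteq> []"
      then obtain y where "walk ch xs q' = Some y" "z \<in> set (ch y)"
        using step[of q' j] snoc.prems(2) unfolding qj by auto
      then show False using assms(5)[OF c] z by blast
    qed
    then show ?thesis using p step[of q' j] snoc.prems(2) assms(3) qj
      by (auto simp: nth_eq_iff_index_eq)
  next
    fix x assume p: "p \<noteq> []" "walk ch xs p = Some x" "i < length (ch x)" "z = ch x ! i"
    have z: "z \<in> set (ch x)" using p by simp
    have "q' \<noteq> []"
    proof
      assume "q' = []"
      then have "z \<in> set xs" using step[of q' j] snoc.prems(2) unfolding qj by auto
      then show False using assms(5)[OF c[OF p(2)]] z by blast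
    qed
    then obtain y where y: "walk ch xs q' = Some y" "j < length (ch y)" "z = ch y ! j"
      using step[of q' j] snoc.prems(2) qj by auto
    have "x = y" using assms(6)[OF c[OF p(2)] c[OF y(1)] z] nth_mem[OF y(2)] y(3) by simp
    moreover from this have "p = q'" using snoc.IH p y by blast
    ultimately show ?thesis using p y assms(4)[OF c[OF p(2)]] qj
      by (auto simp: nth_eq_iff_index_eq)
  qed
qed simp

text \<open>
  The measure \<open>m\<close> ensures that the search for predecessors ends at a starting point.
\<close>

lemma walk_surj:
  fixes m :: "'x \<Rightarrow> nat"
  assumes "\<And>x. x \<in> V \<Longrightarrow> x \<in> set xs \<or> (\<exists>y\<in>V. x \<in> set (ch y) \<and> m y < m x)" and "x \<in> V"
  shows "\<exists>p. walk ch xs p = Some x"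
  using assms(2)
proof (induction "m x" arbitrary: x rule: less_induct)
  case less
  from assms(1)[OF less.prems] show ?case
  proof
    assume "x \<in> set xs"
    then obtain i where "i < length xs" "x = xs ! i" by (auto simp: in_set_conv_nth)
    then show ?thesis by (intro exI[of _ "[i]"]) simp
  next
    assume "\<exists>y\<in>V. x \<in> set (ch y) \<and> m y < m x"
    then obtain y p where y: "x \<in> set (ch y)" "walk ch xs p = Some y" using less.hyps by blast
    then obtain i where "i < length (ch y)" "x = ch y ! i" by (auto simp: in_set_conv_nth)
    then have "walk ch xs (p @ [i]) = Some x" using y by (cases "p = []") (auto simp: walk_snoc)
    then show ?thesis by blast
  qed
qed

lemma distinct_concat_map:
  assumes "distinct xs" "\<And>x. distinct (f x)" "\<And>x y. x \<noteq> y \<Longrightarrow> set (f x) \<inter> set (f y) = {}"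
  shows "distinct (concat (map f xs))"
  using assms(1)
proof (induction xs)
  case (Cons a xs)
  then have "set (f a) \<inter> set (f b) = {}" if "b \<in> set xs" for b
    using assms(3)[of a b] that by auto
  then show ?case using Cons assms(2) by auto
qed simp

text \<open>
  A partition of a sum as a multiset comes from a partition of the indices of its summands.
\<close>

lemma mset_map_eq:
  "image_mset f (mset xs) = mset ys \<Longrightarrow> \<exists>zs. mset zs = mset xs \<and> map f zs = ys"
proof (induction ys arbitrary: xs)
  case (Cons y ys)
  then have "y \<in># image_mset f (mset xs)" by simp
  then obtain x where x: "x \<in> set xs" "f x = y" by auto
  then obtain us vs where xs: "xs = us @ x # vs" using split_list by metis
  then have "image_mset f (mset (us @ vs)) = mset ys" using Cons.prems x by simp
  then obtain zs where "mset zs = mset (us @ vs)" "map f zs = ys" using Cons.IH by blast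
  then show ?case using x xs by (intro exI[of _ "x # zs"]) simp
qed simp

section \<open>Nodes of a forest\<close>

lemma node_at_single: "node_at G [i] = (if i < length G then Some (root_node (G ! i)) else None)"
  by (simp add: node_at_def)

lemma node_at_snoc:
  "p \<noteq> [] \<Longrightarrow> node_at G (p @ [i]) =
    (case node_at G p of None \<Rightarrow> None
     | Some n \<Rightarrow> if i < length (successors n) then Some (successors n ! i) else None)"
  by (simp add: node_at_def node_in_eq_walk walk_snoc)

lemma node_at_Nil [simp]: "node_at G [] = None"
  by (simp add: node_at_def)

lemma nodes_D: "p \<in> nodes G \<Longrightarrow> \<exists>n. node_at G p = Some n"
  by (auto simp: nodes_def)

lemma is_successor_iff:
  "is_successor G p q \<longleftrightarrow>
    (\<exists>n i. node_at G p = Some n \<and> i < length (successors n) \<and> q = p @ [i])"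
proof (cases "p = []")
  case False
  then show ?thesis
    by (auto simp: is_successor_def nodes_def node_at_snoc split: if_splits option.splits)
qed (auto simp: is_successor_def nodes_def)

lemma nodes_snocD: "p @ [i] \<in> nodes G \<Longrightarrow> p \<noteq> [] \<Longrightarrow> is_successor G p (p @ [i])"
  by (auto simp: is_successor_iff nodes_def node_at_snoc split: if_splits option.splits)

lemma nodes_appendD: "p @ q \<in> nodes G \<Longrightarrow> p \<noteq> [] \<Longrightarrow> p \<in> nodes G"
proof (induction q rule: rev_induct)
  case (snoc i q)
  then show ?case using nodes_snocD[of "p @ q" i G] by (auto simp: is_successor_def)
qed simp

lemma is_successor_node_at:
  "is_successor G p q \<Longrightarrow> node_at G p = Some n \<Longrightarrow> \<exists>i < length (successors n). q = p @ [i] \<and> node_at G q = Some (successors n ! i)"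
proof -
  assume "is_successor G p q" "node_at G p = Some n"
  moreover have "p \<noteq> []" using calculation by auto
  ultimately show ?thesis by (auto simp: is_successor_iff node_at_snoc)
qed

lemma successors_not_cut: "NCut u v \<notin> set (successors n)"
  by (induction n rule: successors.induct) auto

lemma NWit_in_successorsD: "NWit w \<in> set (successors n) \<Longrightarrow> \<exists>vs. n = NTree (Expansion vs)"
  by (induction n rule: successors.induct) auto

fun is_switched_node :: "'v node \<Rightarrow> bool" where
  "is_switched_node (NTree (Expansion ws)) = True"
| "is_switched_node (NTree (Or t s)) = True"
| "is_switched_node _ = False"

lemma switched_iff: "switched G p \<longleftrightarrow> (\<exists>n. node_at G p = Some n \<and> is_switched_node n)"
  unfolding switched_def by (auto elim: is_switched_node.elims)

text \<open>
  Subterms of a typed forest are typed. This is needed because an empty expansion would have no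
  successor to choose, and then there would be no switching at all.
\<close>

primrec typed_node :: "('v \<Rightarrow> 'a) \<Rightarrow> 'v node \<Rightarrow> bool" where
  "typed_node \<tau> (NTree t) = (\<exists>A. typed_tree \<tau> t A)"
| "typed_node \<tau> (NWit w) = (\<exists>P. typed_wit \<tau> w P)"
| "typed_node \<tau> NStar = True"
| "typed_node \<tau> (NCut t s) = ((\<exists>A. typed_tree \<tau> t A) \<and> (\<exists>A. typed_tree \<tau> s A))"

lemma typed_successors: "typed_node \<tau> n \<Longrightarrow> m \<in> set (successors n) \<Longrightarrow> typed_node \<tau> m"
  by (induction n rule: successors.induct)
    (auto elim: typed_tree.cases typed_wit.cases simp: typed_tree.simps[of _ "Expansion _"]
      typed_tree.simps[of _ "Or _ _"] typed_tree.simps[of _ "OrL _"] typed_tree.simps[of _ "OrR _"]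
      typed_wit.simps[of _ "Tensor _ _"], blast)

lemma typed_node_at:
  assumes "\<forall>m\<in>set G. typed_member \<tau> m" "node_at G p = Some n"
  shows "typed_node \<tau> n"
proof -
  have "n \<in> {n. typed_node \<tau> n}"
  proof (rule walk_closed[where ch = successors])
    show "set (map root_node G) \<subseteq> {n. typed_node \<tau> n}"
    proof clarsimp
      fix m assume "m \<in> set G"
      then have "typed_member \<tau> m" using assms(1) by blast
      then show "typed_node \<tau> (root_node m)" by (cases m) auto
    qed
  qed (use assms(2) typed_successors in \<open>auto simp: node_at_def node_in_eq_walk\<close>)
  then show ?thesis by simp
qed

lemma switched_has_successor:
  assumes "typed_forest G" "switched G p"
  shows "\<exists>q. is_successor G p q"
proof -
  obtain \<tau> n where *: "\<forall>m\<in>set G. typed_member \<tau> m" "node_at G p = Some n" "is_switched_node n"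
    using assms by (auto simp: typed_forest_def switched_iff)
  then have "typed_node \<tau> n" using typed_node_at by blast
  with *(3) have "0 < length (successors n)"
    by (cases n rule: is_switched_node.cases) (auto elim: typed_tree.cases)
  with *(2) show ?thesis by (auto simp: is_successor_iff)
qed

section \<open>Duplicated terms\<close>

lemma successors_map_node: "successors (map_node f n) = map (map_node f) (successors n)"
  by (induction n rule: successors.induct) auto

lemma dup_sum_eq:
  "dup_sum l r D p i vs =
    concat (map (\<lambda>j. if p @ [i + j] \<in> D then [map_wit l (vs ! j), map_wit r (vs ! j)]
      else [dup_wit l r D (p @ [i + j]) (vs ! j)]) [0..<length vs])"
proof (induction vs arbitrary: i)
  case (Cons w vs)
  show ?case
    by (simp add: upt_conv_Cons map_Suc_upt[symmetric] Cons.IH comp_def del: upt_Suc cong: if_cong)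
qed simp

text \<open>
  Nothing changes in a term below which no position of \<open>D\<close> lies; this is the case for the summands of \<open>s\<close>.
\<close>

lemma dup_below_id:
  "(\<And>q. p @ q \<notin> D) \<Longrightarrow> dup_tree l r D p u = u"
  "(\<And>q. p @ q \<notin> D) \<Longrightarrow> dup_wit l r D p w = w"
proof (induction u and w arbitrary: p and p)
  case (Expansion vs)
  have "p @ [j] \<notin> D" for j using Expansion.prems by blast
  moreover have "dup_wit l r D (p @ [j]) (vs ! j) = vs ! j" if "j < length vs" for j
    using Expansion.IH[of "vs ! j" "p @ [j]"] Expansion.prems that by simp
  ultimately have "dup_sum l r D p 0 vs = concat (map (\<lambda>j. [vs ! j]) [0..<length vs])"
    unfolding dup_sum_eq by (intro arg_cong[of _ _ concat] map_cong) auto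
  then show ?case by (simp add: map_nth)
qed simp_all

lemma is_switched_map_node: "is_switched_node (map_node f n) \<longleftrightarrow> is_switched_node n"
  by (cases n rule: is_switched_node.cases) auto

section \<open>Switching graphs\<close>

lemma switching_adj_sym: "switching_adj G \<sigma> p q \<longleftrightarrow> switching_adj G \<sigma> q p"
  by (auto simp: switching_adj_def)

lemma switching_adj_nodes: "switching_adj G \<sigma> p q \<Longrightarrow> p \<in> nodes G \<and> q \<in> nodes G"
  by (auto simp: switching_adj_def kept_edge_def axiom_link_def is_successor_def nodes_def)

lemma successively_switching_adj_rev:
  "successively (switching_adj G \<sigma>) (rev ps) \<longleftrightarrow> successively (switching_adj G \<sigma>) ps"
  using switching_adj_sym[of G \<sigma>] by (simp add: successively_rev)

lemma switching_cycle_rotate: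
  assumes "switching_cycle G \<sigma> ps" "p \<in> set ps"
  shows "\<exists>qs. switching_cycle G \<sigma> (p # qs) \<and> set (p # qs) = set ps"
proof -
  obtain xs ys where ps: "ps = xs @ p # ys" using split_list[OF assms(2)] by blast
  have "switching_cycle G \<sigma> (p # ys @ xs)"
    using assms(1) unfolding ps switching_cycle_def
    by (cases "xs = []"; cases "ys = []") (auto simp: successively_append_iff successively_Cons hd_append)
  then show ?thesis using ps by (intro exI[of _ "ys @ xs"]) auto
qed

lemma switching_cycle_nodes: "switching_cycle G \<sigma> ps \<Longrightarrow> set ps \<subseteq> nodes G"
proof
  fix p assume *: "switching_cycle G \<sigma> ps" "p \<in> set ps"
  obtain qs where "switching_cycle G \<sigma> (p # qs)" using switching_cycle_rotate[OF *] by blast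
  then show "p \<in> nodes G"
    using switching_adj_nodes[of G \<sigma> p "hd qs"]
    by (cases qs) (auto simp: switching_cycle_def successively_Cons)
qed

text \<open>
  Around the first element satisfying \<open>Q\<close> and the last one before it satisfying \<open>P\<close>.
\<close>

lemma split_between:
  assumes "xs \<noteq> []" "P (hd xs)" "Q (last xs)" "\<And>x. P x \<Longrightarrow> \<not> Q x"
  shows "\<exists>us a vs b ws. xs = us @ a # vs @ b # ws \<and> P a \<and> Q b \<and> (\<forall>v\<in>set vs. \<not> P v \<and> \<not> Q v)"
proof -
  have "\<exists>x\<in>set xs. Q x" using assms by auto
  then obtain ys b ws where ys: "xs = ys @ b # ws" "Q b" "\<forall>y\<in>set ys. \<not> Q y"
    using split_list_first_prop by metis
  then have "ys \<noteq> []" using assms by auto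
  then have "\<exists>y\<in>set ys. P y" using assms ys by (intro bexI[of _ "hd ys"]) auto
  then obtain us a vs where "ys = us @ a # vs" "P a" "\<forall>v\<in>set vs. \<not> P v"
    using split_list_last_prop by metis
  then show ?thesis using ys
    by (intro exI[of _ us] exI[of _ a] exI[of _ vs] exI[of _ b] exI[of _ ws]) auto
qed

section \<open>Typing and wire variables\<close>

lemma typed_map:
  "typed_tree \<tau> u A \<Longrightarrow> (\<forall>x\<in>set_tree u. \<tau>' (f x) = \<tau> x) \<Longrightarrow> typed_tree \<tau>' (map_tree f u) A"
  "typed_wit \<tau> w P \<Longrightarrow> (\<forall>x\<in>set_wit w. \<tau>' (f x) = \<tau> x) \<Longrightarrow> typed_wit \<tau>' (map_wit f w) P"
proof (induction rule: typed_tree_typed_wit.inducts)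
  case (2 ws P)
  then show ?case by (auto intro!: typed_tree_typed_wit.intros(2))
next
  case (6 x)
  then show ?case using typed_tree_typed_wit.intros(6)[of \<tau>' "f x"] by simp
next
  case (7 x)
  then show ?case using typed_tree_typed_wit.intros(7)[of \<tau>' "f x"] by simp
qed (auto intro: typed_tree_typed_wit.intros)

lemma typed_cong:
  "typed_tree \<tau> u A \<Longrightarrow> (\<forall>x\<in>set_tree u. \<tau>' x = \<tau> x) \<Longrightarrow> typed_tree \<tau>' u A"
  "typed_wit \<tau> w P \<Longrightarrow> (\<forall>x\<in>set_wit w. \<tau>' x = \<tau> x) \<Longrightarrow> typed_wit \<tau>' w P"
  using typed_map[where f = id] by (fastforce simp: tree.map_id wit.map_id)+

primrec node_wires :: "'v node \<Rightarrow> 'v set" where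
  "node_wires (NTree u) = set_tree u"
| "node_wires (NWit w) = set_wit w"
| "node_wires NStar = {}"
| "node_wires (NCut u v) = set_tree u \<union> set_tree v"

lemma node_wires_cases:
  assumes "x \<in> node_wires n"
  shows "n = NWit (Wire x) \<or> n = NWit (DWire x) \<or> (\<exists>i < length (successors n). x \<in> node_wires (successors n ! i))"
proof -
  have "n = NWit (Wire x) \<or> n = NWit (DWire x) \<or> (\<exists>m\<in>set (successors n). x \<in> node_wires m)"
    using assms by (cases n rule: successors.cases) auto
  then show ?thesis by (auto simp: in_set_conv_nth)
qed

text \<open>
  The measure for induction along positions.
\<close>

primrec node_size :: "'v node \<Rightarrow> nat" where
  "node_size (NTree u) = size u"
| "node_size (NWit w) = size w"
| "node_size NStar = 0"
| "node_size (NCut u v) = Suc (size u + size v)"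

lemma node_size_successors: "m \<in> set (successors n) \<Longrightarrow> node_size m < node_size n"
  by (cases n rule: successors.cases) (auto dest!: size_list_estimation'[where f = size, OF _ order_refl] simp: less_Suc_eq_le)

text \<open>
  Each wire variable of a subterm occurs at a node below it, which relates the freshness conditions,
  stated for occurrences, to the variables of the terms that are renamed.
\<close>

lemma node_wires_position:
  "node_at G p = Some n \<Longrightarrow> x \<in> node_wires n \<Longrightarrow>
    \<exists>q. node_at G (p @ q) = Some (NWit (Wire x)) \<or> node_at G (p @ q) = Some (NWit (DWire x))"
proof (induction "node_size n" arbitrary: n p rule: less_induct)
  case less
  from node_wires_cases[OF less.prems(2)] show ?case
  proof (elim disjE exE conjE)
    fix i assume i: "i < length (successors n)" "x \<in> node_wires (successors n ! i)"
    then have "node_at G (p @ [i]) = Some (successors n ! i)"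
      using less.prems(1) by (cases "p = []") (auto simp: node_at_snoc)
    then have "\<exists>q. node_at G ((p @ [i]) @ q) = Some (NWit (Wire x)) \<or> node_at G ((p @ [i]) @ q) = Some (NWit (DWire x))"
      using less.hyps[OF _ _ i(2)] node_size_successors i(1) nth_mem by blast
    then show ?thesis by auto
  qed (use less.prems in \<open>auto intro: exI[of _ "[]"]\<close>)
qed

section \<open>The duplicated part\<close>

text \<open>
  A node of the reduced forest is labelled by a tag and a position in the given forest. The label
  \<open>(Added, p)\<close> belongs to the expansion \<open>(w\<^sup>L + w\<^sup>R)\<close> that replaces the witness \<open>w\<close> at the root \<open>p\<close>.
\<close>

datatype tag = Kept | LCopy | RCopy | Added

text \<open>
  The situation of the theorem, with the two parts of the positive side \<open>s\<close> given by lists of indices of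
  its summands.
\<close>

locale cut_duplication =
  fixes F G :: "('v, 'a) forest" and ws :: "'v wit list" and t :: "'v tree"
    and H D :: "position set" and l r :: "'v \<Rightarrow> 'v" and ix1 ix2 :: "nat list"
  assumes G_eq: "G = F @ [Cut (Expansion ws) t]"
    and typed: "typed_forest G"
    and subnet: "subnet G H"
    and arg_root: "[length F, 1] \<in> roots G H"
    and D_eq: "D = roots G H - {[length F, 1]}"
    and D_nodes: "p \<in> D \<Longrightarrow> (\<exists>w. node_at G p = Some (NWit w)) \<or> (\<exists>u v. node_at G p = Some (NCut u v))"
    and fresh: "fresh_copies l r (wires_in G H) (wires_in G (nodes G))"
    and ix_distinct: "distinct (ix1 @ ix2)"
    and ix_set: "set (ix1 @ ix2) = {..<length ws}"
begin

abbreviation cut_pos :: position where "cut_pos \<equiv> [length F]"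
abbreviation sum_pos :: position where "sum_pos \<equiv> [length F, 0]"
abbreviation arg_pos :: position where "arg_pos \<equiv> [length F, 1]"

lemma node_at_cut: "node_at G cut_pos = Some (NCut (Expansion ws) t)"
  by (simp add: node_at_single G_eq)

lemma node_at_sum: "node_at G sum_pos = Some (NTree (Expansion ws))"
  using node_at_snoc[of cut_pos G 0] by (simp add: node_at_cut)

lemma node_at_arg: "node_at G arg_pos = Some (NTree t)"
  using node_at_snoc[of cut_pos G 1] by (simp add: node_at_cut)

lemma node_at_summand: "i < length ws \<Longrightarrow> node_at G [length F, 0, i] = Some (NWit (ws ! i))"
  using node_at_snoc[of sum_pos G i] by (simp add: node_at_sum)

lemma substr: "substructure G H"
  using subnet by (simp add: subnet_def)

lemma H_nodes: "p \<in> H \<Longrightarrow> p \<in> nodes G"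
  using substr unfolding substructure_def by blast

lemma H_successor: "p \<in> H \<Longrightarrow> is_successor G p q \<Longrightarrow> q \<in> H"
  using substr unfolding substructure_def by blast

lemma H_axiom: "axiom_link G p q \<Longrightarrow> p \<in> H \<longleftrightarrow> q \<in> H"
  using substr unfolding substructure_def by blast

lemma H_extend: "p \<in> H \<Longrightarrow> p @ q \<in> nodes G \<Longrightarrow> p @ q \<in> H"
proof (induction q rule: rev_induct)
  case (snoc i q)
  have "p \<noteq> []" using H_nodes[OF snoc.prems(1)] by (auto simp: nodes_def)
  then have "is_successor G (p @ q) ((p @ q) @ [i])"
    using nodes_snocD[of "p @ q" i G] snoc.prems by simp
  then show ?case using snoc H_successor by (auto simp: is_successor_def)
qed simp

lemma D_in_H: "p \<in> D \<Longrightarrow> p \<in> H"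
  by (simp add: D_eq roots_def)

lemma cut_successors:
  "is_successor G cut_pos sum_pos" "is_successor G cut_pos arg_pos"
  by (auto simp: is_successor_iff node_at_cut)

lemma cut_notin_H: "cut_pos \<notin> H"
  using arg_root cut_successors by (auto simp: roots_def)

lemma cut_not_switched: "\<not> switched G cut_pos"
  by (simp add: switched_iff node_at_cut)

lemma H_below_root: "p \<in> H \<Longrightarrow> \<exists>q s. p = q @ s \<and> q \<in> roots G H"
proof (induction p rule: rev_induct)
  case (snoc i p)
  show ?case
  proof (cases "p @ [i] \<in> roots G H")
    case True
    then show ?thesis by (metis append_Nil2)
  next
    case False
    then obtain p' where "p' \<in> H" "is_successor G p' (p @ [i])"
      using snoc.prems unfolding roots_def by blast
    then have "p \<in> H" by (simp add: is_successor_def)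
    then show ?thesis using snoc.IH by (metis append_assoc)
  qed
next
  case Nil
  then show ?case using H_nodes[of "[]"] by (simp add: nodes_def)
qed

text \<open>
  If \<open>H\<close> met the tree \<open>s\<close>, a root of \<open>H\<close> would lie in \<open>s\<close>. Ascending from it to \<open>s\<close> and to the cut and
  then descending to \<open>t\<close> is a switching path between two roots of \<open>H\<close>, but the cut is not in \<open>H\<close>.
\<close>

lemma H_avoids_sum: "sum_pos @ q \<notin> H"
proof
  assume "sum_pos @ q \<in> H"
  from H_below_root[OF this] obtain u v where uv: "sum_pos @ q = u @ v" "u \<in> roots G H"
    by blast
  then have uH: "u \<in> H" by (simp add: roots_def)
  have u: "u \<in> nodes G" using H_nodes uH by blast
  have "u \<noteq> []" "u \<noteq> cut_pos" using uH u cut_notin_H by (auto simp: nodes_def)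
  then obtain q' where q': "u = sum_pos @ q'"
    using uv(1) by (cases u; cases "tl u") auto
  have tk: "take k u \<in> nodes G" if "0 < k" for k
    using nodes_appendD[of "take k u" "drop k u" G] u that q' by (cases k) auto
  have suc: "is_successor G (take k u) (take (Suc k) u)" if "0 < k" "k < length u" for k
    using tk[of k] tk[of "Suc k"] that
    by (auto simp: is_successor_def take_Suc_conv_app_nth)
  \<comment> \<open>Each node on the way to \<open>u\<close> chooses its successor on that way.\<close>
  define \<sigma> where "\<sigma> p = (if \<exists>k. 0 < k \<and> k < length u \<and> p = take k u
    then take (Suc (length p)) u else SOME q. is_successor G p q)" for p
  have \<sigma>: "is_switching G \<sigma>"
    unfolding is_switching_def
  proof (intro allI impI)
    fix p assume "switched G p"
    then have "is_successor G p (SOME q. is_successor G p q)"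
      using switched_has_successor[OF typed] by (metis someI_ex)
    then show "is_successor G p (\<sigma> p)" using suc by (auto simp: \<sigma>_def)
  qed
  have adj: "switching_adj G \<sigma> (take (Suc k) u) (take k u)" if "0 < k" "k < length u" for k
    using suc[OF that] that by (auto simp: switching_adj_def kept_edge_def \<sigma>_def)
  \<comment> \<open>The nonempty prefixes of \<open>u\<close> from \<open>u\<close> up to the cut, and then \<open>t\<close>.\<close>
  define ps where "ps = map (\<lambda>k. take k u) (rev [1..<Suc (length u)]) @ [arg_pos]"
  have "switching_path G ps"
    unfolding switching_path_def
  proof (intro conjI exI[of _ \<sigma>])
    show "set ps \<subseteq> nodes G" using tk u arg_root H_nodes by (auto simp: ps_def roots_def)
    have "arg_pos \<noteq> take k u" for k
      by (simp add: q' take_Cons')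
    moreover have "inj_on (\<lambda>k. take k u) {Suc 0..<Suc (length u)}"
      by (auto intro!: inj_onI dest: arg_cong[of _ _ length])
    ultimately show "distinct ps" by (auto simp: ps_def distinct_map simp del: upt_Suc)
    have "successively (\<lambda>i j. switching_adj G \<sigma> (take j u) (take i u)) [1..<Suc (length u)]"
      using adj by (auto simp: successively_conv_nth simp del: upt_Suc)
    moreover have "switching_adj G \<sigma> (take 1 u) arg_pos"
      using cut_successors cut_not_switched q' by (auto simp: switching_adj_def kept_edge_def)
    ultimately show "successively (switching_adj G \<sigma>) ps"
      using q' by (auto simp: ps_def successively_append_iff successively_map
          last_map last_rev hd_map simp del: upt_Suc)
  qed (use \<sigma> in \<open>auto simp: ps_def\<close>)
  moreover have "hd ps = u" "last ps = arg_pos" using q' by (auto simp: ps_def)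
  ultimately have "set ps \<subseteq> H" using subnet uv(2) arg_root by (auto simp: subnet_def)
  moreover have "cut_pos \<in> set ps"
    using q' by (auto simp: ps_def simp del: upt_Suc intro!: image_eqI[of _ _ 1])
  ultimately show False using cut_notin_H by blast
qed

lemma sum_notin_H: "sum_pos \<notin> H" and summand_notin_H: "[length F, 0, i] \<notin> H"
  using H_avoids_sum[of "[]"] H_avoids_sum[of "[i]"] by auto

section \<open>Labels of the nodes of the reduced forest\<close>

text \<open>
  Besides \<open>H\<close>, the cut and its positive side \<open>s\<close> occur twice. The summands of \<open>s\<close> occur once: they are
  divided between the two copies of \<open>s\<close>.
\<close>

definition doubled :: "position set" where "doubled = H \<union> {cut_pos, sum_pos}"

primrec ren :: "tag \<Rightarrow> 'v \<Rightarrow> 'v" where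
  "ren Kept = id" | "ren LCopy = l" | "ren RCopy = r" | "ren Added = id"

primrec summands :: "tag \<Rightarrow> nat list" where
  "summands Kept = []" | "summands LCopy = ix1" | "summands RCopy = ix2" | "summands Added = []"

definition arity :: "position \<Rightarrow> nat" where
  "arity p = length (successors (the (node_at G p)))"

text \<open>
  In a list of successors, and likewise in the list of members, a node in \<open>D\<close> gives way to its two copies.
\<close>

definition copies :: "position \<Rightarrow> (tag \<times> position) list" where
  "copies p = (if p \<in> D then [(LCopy, p), (RCopy, p)] else [(Kept, p)])"

text \<open>
  The doubled part ends at \<open>s\<close>: the successors of both copies of \<open>s\<close> are kept nodes.
\<close>

fun children :: "tag \<times> position \<Rightarrow> (tag \<times> position) list" where
  "children (Kept, p) = concat (map (\<lambda>i. copies (p @ [i])) [0..<arity p])"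
| "children (Added, p) = [(LCopy, p), (RCopy, p)]"
| "children (k, p) =
    (if p = sum_pos then map (\<lambda>i. (Kept, sum_pos @ [i])) (summands k)
     else map (\<lambda>i. (k, p @ [i])) [0..<arity p])"

definition root_copies :: "position \<Rightarrow> (tag \<times> position) list" where
  "root_copies p =
    (if p \<in> D \<and> (\<exists>w. node_at G p = Some (NWit w)) then [(Added, p)] else copies p)"

definition starts :: "(tag \<times> position) list" where
  "starts =
    concat (map (\<lambda>i. root_copies [i]) [0..<length F]) @ [(LCopy, cut_pos), (RCopy, cut_pos)]"

text \<open>
  The labels that occur; \<open>label_valid\<close>, \<open>label_inj\<close> and \<open>label_surj\<close> below show that they are in
  bijection with the nodes of the reduced forest.
\<close>

definition valid :: "(tag \<times> position) set" where
  "valid = {(k, p). case k of Kept \<Rightarrow> p \<in> nodes G - doubled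
    | Added \<Rightarrow> p \<in> D \<and> length p = 1 \<and> (\<exists>w. node_at G p = Some (NWit w))
    | _ \<Rightarrow> p \<in> doubled}"

lemma valid_simps:
  "(Kept, p) \<in> valid \<longleftrightarrow> p \<in> nodes G \<and> p \<notin> doubled"
  "(LCopy, p) \<in> valid \<longleftrightarrow> p \<in> doubled"
  "(RCopy, p) \<in> valid \<longleftrightarrow> p \<in> doubled"
  "(Added, p) \<in> valid \<longleftrightarrow> p \<in> D \<and> length p = 1 \<and> (\<exists>w. node_at G p = Some (NWit w))"
  by (auto simp: valid_def)

fun dup_node :: "position \<Rightarrow> 'v node \<Rightarrow> 'v node" where
  "dup_node p (NTree u) = NTree (dup_tree l r D p u)"
| "dup_node p (NWit w) = NWit (dup_wit l r D p w)"
| "dup_node p NStar = NStar"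
| "dup_node p (NCut u v) = NCut (dup_tree l r D (p @ [0]) u) (dup_tree l r D (p @ [1]) v)"

text \<open>
  The copies of the cut and of \<open>s\<close> differ from renamed subterms, since the summands of \<open>s\<close> are neither
  renamed nor repeated. By \<open>successors_contents\<close> below this describes every node of the reduced forest.
\<close>

fun contents :: "tag \<times> position \<Rightarrow> 'v node" where
  "contents (Kept, p) = dup_node p (the (node_at G p))"
| "contents (Added, p) =
    NTree (Expansion (case the (node_at G p) of NWit w \<Rightarrow> [map_wit l w, map_wit r w]))"
| "contents (k, p) =
    (if p = cut_pos then NCut (Expansion (map (nth ws) (summands k))) (map_tree (ren k) t)
     else if p = sum_pos then NTree (Expansion (map (nth ws) (summands k)))
     else map_node (ren k) (the (node_at G p)))"

lemma doubled_nodes: "p \<in> doubled \<Longrightarrow> p \<in> nodes G"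
  using H_nodes cut_successors by (auto simp: doubled_def is_successor_def)

lemma D_doubled: "p \<in> D \<Longrightarrow> p \<in> doubled"
  by (simp add: doubled_def D_in_H)

lemma arity_successor: "p \<in> nodes G \<Longrightarrow> i < arity p \<longleftrightarrow> is_successor G p (p @ [i])"
  by (auto simp: is_successor_iff arity_def dest!: nodes_D)

lemma is_successor_unique: "is_successor G p q \<Longrightarrow> is_successor G p' q \<Longrightarrow> p = p'"
  by (auto simp: is_successor_def)

lemma arity_cut: "arity cut_pos = 2" and arity_sum: "arity sum_pos = length ws"
  by (simp_all add: arity_def node_at_cut node_at_sum)

text \<open>
  A node in \<open>D\<close> is a witness or a cut. Cuts have no predecessor, and a witness can only be a summand, so
  passing to a root in \<open>D\<close> always means passing to a summand of a switched node.
\<close>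

lemma D_successor:
  assumes "is_successor G p q" "q \<in> D"
  shows "(\<exists>vs. node_at G p = Some (NTree (Expansion vs))) \<and> (\<exists>w. node_at G q = Some (NWit w))"
proof -
  obtain n i where n: "node_at G p = Some n" "i < length (successors n)"
      "node_at G q = Some (successors n ! i)"
    using is_successor_node_at[OF assms(1)] assms(1) by (auto simp: is_successor_iff)
  then have "successors n ! i \<in> set (successors n)" by simp
  then show ?thesis
    using D_nodes[OF assms(2)] n NWit_in_successorsD successors_not_cut by (metis option.inject)
qed

text \<open>
  From above, \<open>H\<close> is entered only at \<open>D\<close> or, coming from the cut, at \<open>t\<close>.
\<close>

lemma root_of_H: "is_successor G p q \<Longrightarrow> p \<notin> H \<Longrightarrow> p \<noteq> cut_pos \<Longrightarrow> q \<in> H \<Longrightarrow> q \<in> D"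
  using is_successor_unique cut_successors(2) by (auto simp: D_eq roots_def)

lemma D_topmost: "q \<in> D \<Longrightarrow> is_successor G p q \<Longrightarrow> p \<notin> H"
  unfolding D_eq roots_def by blast

lemma doubled_child: "p \<in> doubled \<Longrightarrow> p \<noteq> sum_pos \<Longrightarrow> is_successor G p q \<Longrightarrow> q \<in> doubled \<and> q \<notin> D"
proof (cases "p = cut_pos")
  case True
  assume "is_successor G p q"
  then have "q = sum_pos \<or> q = arg_pos"
    using True by (auto simp: is_successor_iff node_at_cut less_Suc_eq)
  moreover have "arg_pos \<in> H" "arg_pos \<notin> D" "sum_pos \<notin> D"
    using arg_root sum_notin_H D_in_H unfolding D_eq roots_def by blast+
  ultimately show ?thesis unfolding doubled_def by blast
next
  case False
  assume "p \<in> doubled" "p \<noteq> sum_pos" and s: "is_successor G p q"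
  then have "p \<in> H" using False by (simp add: doubled_def)
  then show ?thesis using H_successor s D_topmost unfolding doubled_def by blast
qed

lemma sum_child: "is_successor G sum_pos q \<Longrightarrow> q \<in> nodes G \<and> q \<notin> doubled"
  using summand_notin_H by (auto simp: is_successor_def doubled_def)

lemma kept_child:
  assumes "p \<in> nodes G" "p \<notin> doubled" "is_successor G p q" "q \<notin> D"
  shows "q \<in> nodes G \<and> q \<notin> doubled"
proof -
  have "q \<notin> H" using root_of_H assms unfolding doubled_def by blast
  moreover have "q \<noteq> cut_pos" using assms by (auto simp: is_successor_def nodes_def)
  moreover have "q \<noteq> sum_pos" using is_successor_unique[OF cut_successors(1)] assms unfolding doubled_def by blast
  moreover have "q \<in> nodes G" using assms by (simp add: is_successor_def)
  ultimately show ?thesis unfolding doubled_def by blast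
qed

lemma ix_less:
  assumes "k = LCopy \<or> k = RCopy" "i \<in> set (summands k)"
  shows "i < length ws"
proof -
  have "i \<in> set (ix1 @ ix2)" using assms by auto
  then show ?thesis unfolding ix_set by simp
qed

lemma successor_index: "is_successor G p q \<Longrightarrow> \<exists>i < arity p. q = p @ [i]"
  by (auto simp: is_successor_iff arity_def)

lemma successor_index_iff: "p \<in> nodes G \<Longrightarrow> is_successor G p q \<longleftrightarrow> (\<exists>i < arity p. q = p @ [i])"
  using successor_index arity_successor by blast

lemma in_children_Kept:
  assumes "p \<in> nodes G"
  shows "(k, q) \<in> set (children (Kept, p)) \<longleftrightarrow>
    is_successor G p q \<and> (if q \<in> D then k = LCopy \<or> k = RCopy else k = Kept)"
proof -
  have "(k, q) \<in> set (copies u) \<longleftrightarrow>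
      q = u \<and> (if q \<in> D then k = LCopy \<or> k = RCopy else k = Kept)" for u
    by (auto simp: copies_def)
  then show ?thesis unfolding successor_index_iff[OF assms] by auto
qed

lemma in_children_copy:
  assumes "k = LCopy \<or> k = RCopy" "p \<in> doubled"
  shows "(k', q) \<in> set (children (k, p)) \<longleftrightarrow>
    is_successor G p q \<and>
    (if p = sum_pos then k' = Kept \<and> last q \<in> set (summands k) else k' = k)"
proof (cases "p = sum_pos")
  case True
  have "(k', q) \<in> set (children (k, p)) \<longleftrightarrow> k' = Kept \<and> (\<exists>i\<in>set (summands k). q = sum_pos @ [i])"
    using assms(1) True by (elim disjE) auto
  also have "\<dots> \<longleftrightarrow> is_successor G p q \<and> k' = Kept \<and> last q \<in> set (summands k)"
    unfolding successor_index_iff[OF doubled_nodes[OF assms(2)]]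
    using True ix_less[OF assms(1)] arity_sum by auto
  finally show ?thesis using True by simp
next
  case False
  have "(k', q) \<in> set (children (k, p)) \<longleftrightarrow> k' = k \<and> (\<exists>i < arity p. q = p @ [i])"
    using assms(1) False by (elim disjE) auto
  also have "\<dots> \<longleftrightarrow> is_successor G p q \<and> k' = k"
    unfolding successor_index_iff[OF doubled_nodes[OF assms(2)]] by blast
  finally show ?thesis using False by simp
qed

lemma children_valid:
  assumes "x \<in> valid"
  shows "set (children x) \<subseteq> valid"
proof
  fix y assume y: "y \<in> set (children x)"
  obtain k p k' q where xy: "x = (k, p)" "y = (k', q)" by (cases x, cases y)
  show "y \<in> valid"
  proof (cases k)
    case Kept
    then have "p \<in> nodes G" "p \<notin> doubled" using assms xy by (simp_all add: valid_simps)
    then show ?thesis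
      using y xy Kept in_children_Kept[of p k' q] kept_child[of p q] D_doubled[of q]
      by (auto simp: valid_simps simp del: children.simps split: if_splits)
  next
    case Added
    then show ?thesis using assms y xy D_doubled by (auto simp: valid_simps)
  next
    case LCopy
    then have "p \<in> doubled" using assms xy by (simp add: valid_simps)
    then show ?thesis
      using y xy LCopy in_children_copy[of k p k' q] doubled_child[of p q] sum_child[of q]
      by (auto simp: valid_simps simp del: children.simps split: if_splits)
  next
    case RCopy
    then have "p \<in> doubled" using assms xy by (simp add: valid_simps)
    then show ?thesis
      using y xy RCopy in_children_copy[of k p k' q] doubled_child[of p q] sum_child[of q]
      by (auto simp: valid_simps simp del: children.simps split: if_splits)
  qed
qed

lemma tag_cases_valid:
  assumes "(k, p) \<in> valid"
  obtains "k = Kept" "p \<in> nodes G" "p \<notin> doubled" | "k = LCopy \<or> k = RCopy" "p \<in> doubled"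
    | "k = Added" "p \<in> D" "length p = 1" "\<exists>w. node_at G p = Some (NWit w)"
  using assms by (cases k) (auto simp: valid_simps)

lemma child_successor:
  assumes "(k, p) \<in> valid" "(k', q) \<in> set (children (k, p))" "k \<noteq> Added"
  shows "is_successor G p q"
  using assms(1)
proof (cases rule: tag_cases_valid)
  case 1
  then show ?thesis using assms in_children_Kept by blast
next
  case 2
  then show ?thesis using assms in_children_copy by blast
qed (use assms(3) in simp)

lemma Added_not_child:
  assumes "x \<in> valid" "(Added, q) \<in> set (children x)"
  shows False
proof -
  obtain k p where x: "x = (k, p)" by (cases x)
  from assms(1)[unfolded x] show False
  proof (cases rule: tag_cases_valid)
    case 1
    then show ?thesis using assms x in_children_Kept[of p Added q] by (simp split: if_splits)
  next
    case 2
    then show ?thesis using assms x in_children_copy[of k p Added q] by (auto split: if_splits)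
  qed (use assms x in simp)
qed

text \<open>
  The first disjunct comes from the members of \<open>F\<close>, the second from the two new cuts.
\<close>

lemma in_starts:
  "(k, p) \<in> set starts \<longleftrightarrow>
    (\<exists>i < length F. p = [i] \<and>
      (if p \<in> D then if \<exists>w. node_at G p = Some (NWit w) then k = Added else k = LCopy \<or> k = RCopy
       else k = Kept)) \<or>
    (k = LCopy \<or> k = RCopy) \<and> p = cut_pos"
proof -
  have "(k, p) \<in> set (root_copies u) \<longleftrightarrow> p = u \<and>
      (if p \<in> D then if \<exists>w. node_at G p = Some (NWit w) then k = Added else k = LCopy \<or> k = RCopy
       else k = Kept)" for u
    by (auto simp: root_copies_def copies_def)
  then show ?thesis by (auto simp: starts_def simp del: split_paired_Ex)
qed

lemma forest_root_iff: "[i] \<in> nodes G \<longleftrightarrow> i \<le> length F"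
  by (auto simp: nodes_def node_at_single G_eq)

lemma doubled_forest_root: "[i] \<in> doubled \<Longrightarrow> i \<noteq> length F \<Longrightarrow> [i] \<in> D"
  by (auto simp: doubled_def D_eq roots_def is_successor_def nodes_def)

lemma starts_valid: "set starts \<subseteq> valid"
proof
  fix x assume "x \<in> set starts"
  moreover obtain k p where "x = (k, p)" by (cases x)
  moreover have "cut_pos \<in> doubled" by (simp add: doubled_def)
  ultimately show "x \<in> valid" using D_doubled doubled_forest_root[of "hd p"]
    by (auto simp: in_starts valid_simps forest_root_iff split: if_splits)
qed

lemma children_distinct: "distinct (children x)" if "x \<in> valid"
proof -
  obtain k p where x: "x = (k, p)" by (cases x)
  have "distinct (concat (map (\<lambda>i. copies (p @ [i])) [0..<arity p]))"
    by (rule distinct_concat_map) (auto simp: copies_def)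
  then show ?thesis using ix_distinct unfolding x
    by (cases k) (auto simp: distinct_map intro: inj_onI)
qed

lemma starts_distinct: "distinct starts"
proof -
  have "distinct (concat (map (\<lambda>i. root_copies [i]) [0..<length F]))"
    by (rule distinct_concat_map) (auto simp: copies_def root_copies_def)
  then show ?thesis by (auto simp: starts_def root_copies_def copies_def)
qed

lemma child_not_start:
  assumes "x \<in> valid"
  shows "set (children x) \<inter> set starts = {}"
proof -
  have False if *: "y \<in> set (children x)" "y \<in> set starts" for y
  proof -
    obtain k p k' q where xy: "x = (k, p)" "y = (k', q)" by (cases x, cases y)
    have "k = Added"
    proof (rule ccontr)
      assume "k \<noteq> Added"
      then have "is_successor G p q" using child_successor assms * xy by blast
      moreover have "length q = 1" using * xy by (auto simp: in_starts)
      ultimately show False by (auto simp: is_successor_def nodes_def)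
    qed
    then have "(Added, p) \<in> valid" "q = p" "k' = LCopy \<or> k' = RCopy"
      using assms * xy by auto
    then show False using * xy by (auto simp: in_starts valid_simps node_at_cut split: if_splits)
  qed
  then show ?thesis by blast
qed

text \<open>
  The labels determine their predecessors: positions do so up to the tag, and of the two copies of \<open>s\<close>
  only one has a given summand.
\<close>

lemma parent_unique:
  assumes "x \<in> valid" "y \<in> valid" "z \<in> set (children x)" "z \<in> set (children y)"
  shows "x = y"
proof -
  obtain k p k' q k'' u where xyz: "x = (k, p)" "y = (k', q)" "z = (k'', u)"
    by (cases x, cases y, cases z)
  have A: False if "(Added, p) \<in> valid" "z \<in> set (children (Added, p))" "(k, q) \<in> valid" "k \<noteq> Added"
    "z \<in> set (children (k, q))" for k p q
  proof -
    have "u = p" "length p = 1" using that xyz by (auto simp: valid_simps)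
    moreover have "is_successor G q u" using child_successor that xyz by blast
    ultimately show False by (auto simp: is_successor_def nodes_def length_Suc_conv)
  qed
  show ?thesis
  proof (cases "k = Added \<or> k' = Added")
    case True
    then have "k = Added" "k' = Added" using A assms xyz by metis+
    then show ?thesis using assms xyz by auto
  next
    case False
    then have s: "is_successor G p u" "is_successor G q u" using child_successor assms xyz by blast+
    then have pq: "p = q" using is_successor_unique by blast
    have "k = k'"
    proof (cases "p \<in> doubled")
      case True
      then have k: "k = LCopy \<or> k = RCopy" "k' = LCopy \<or> k' = RCopy"
        using assms(1,2) xyz pq False by (auto elim!: tag_cases_valid)
      show ?thesis
      proof (cases "p = sum_pos")
        case p: True
        then have "last u \<in> set (summands k) \<inter> set (summands k')"
          using assms k True xyz pq in_children_copy[of k p] in_children_copy[of k' p] by simp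
        then show ?thesis using k ix_distinct by auto
      next
        case False
        then show ?thesis
          using assms k True xyz pq in_children_copy[of k p] in_children_copy[of k' p] by simp
      qed
    next
      case nK: False
      then show ?thesis using assms(1,2) xyz pq False by (auto elim!: tag_cases_valid)
    qed
    then show ?thesis using pq xyz by simp
  qed
qed

text \<open>
  The measure has to decrease also from \<open>(LCopy, p)\<close> to its predecessor \<open>(Added, p)\<close>, where the position
  stays the same.
\<close>

lemma valid_reached:
  assumes "x \<in> valid"
  shows "\<exists>p. walk children starts p = Some x"
proof (rule walk_surj[where V = valid and m = "\<lambda>(k, p). 2 * length p + (if k = Added then 0 else 1)"])
  fix x assume x: "x \<in> valid"
  obtain k p where xp: "x = (k, p)" by (cases x)
  have pn: "p \<in> nodes G" using x xp doubled_nodes D_doubled by (auto elim!: tag_cases_valid)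
  then have "p \<noteq> []" by (auto simp: nodes_def)
  then consider i where "p = [i]" | p0 i where "p = p0 @ [i]" "p0 \<noteq> []"
    by (metis append_Nil rev_exhaust)
  then show "x \<in> set starts \<or> (\<exists>y\<in>valid. x \<in> set (children y) \<and>
      (case y of (k, p) \<Rightarrow> 2 * length p + (if k = Added then 0 else 1)) <
      (case x of (k, p) \<Rightarrow> 2 * length p + (if k = Added then 0 else 1)))"
  proof cases
    case 1
    show ?thesis
    proof (cases "i = length F")
      case True
      then have "p \<in> doubled" "k \<noteq> Added"
        using 1 x xp by (auto simp: doubled_def valid_simps node_at_cut)
      then show ?thesis using 1 x xp True by (cases k) (auto simp: in_starts valid_simps)
    next
      case False
      then have i: "i < length F" using pn forest_root_iff 1 by auto
      show ?thesis
      proof (cases "k \<noteq> Added \<and> p \<in> D \<and> (\<exists>w. node_at G p = Some (NWit w))")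
        case True
        then have "(Added, p) \<in> valid" "x \<in> set (children (Added, p))"
          using x xp 1 D_doubled by (auto simp: valid_simps elim!: tag_cases_valid)
        then show ?thesis using xp True by (intro disjI2 bexI[of _ "(Added, p)"]) auto
      next
        case F: False
        then have "x \<in> set starts"
          using x 1 i doubled_forest_root[OF _ False] D_doubled unfolding xp
          by (elim tag_cases_valid) (auto simp: in_starts)
        then show ?thesis by blast
      qed
    qed
  next
    case 2
    then have s: "is_successor G p0 p" using nodes_snocD pn by blast
    then have p0: "p0 \<in> nodes G" by (simp add: is_successor_def)
    have kA: "k \<noteq> Added" using 2 x xp by (auto simp: valid_simps)
    have "\<exists>k0. k0 \<noteq> Added \<and> (k0, p0) \<in> valid \<and> x \<in> set (children (k0, p0))"
    proof (cases "p0 \<in> doubled")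
      case False
      have "(k, p) \<in> set (children (Kept, p0))"
        using x[unfolded xp]
      proof (cases rule: tag_cases_valid)
        case 1
        then show ?thesis using s p0 D_doubled by (auto simp: in_children_Kept simp del: children.simps)
      next
        case copied: 2
        have "p \<in> H" using copied False s is_successor_unique[OF _ s] cut_successors
          by (auto simp: doubled_def is_successor_def nodes_def)
        then have "p \<in> D" using root_of_H[OF s] False unfolding doubled_def by blast
        then show ?thesis using copied s p0 by (auto simp: in_children_Kept simp del: children.simps)
      qed (use kA in simp)
      then show ?thesis using False p0 xp by (intro exI[of _ Kept]) (simp add: valid_simps)
    next
      case True
      show ?thesis
      proof (cases "p0 = sum_pos")
        case sp: True
        then have "p \<notin> doubled" using sum_child s by blast
        then have k: "k = Kept" using x kA unfolding xp by (auto elim!: tag_cases_valid)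
        have "last p < length ws" using s sp successor_index arity_sum by force
        then have "last p \<in> set (ix1 @ ix2)" unfolding ix_set by simp
        then have "last p \<in> set ix1 \<or> last p \<in> set ix2" by simp
        then show ?thesis
        proof
          assume "last p \<in> set ix1"
          then show ?thesis using True k xp s sp in_children_copy[of LCopy p0 k p]
            by (intro exI[of _ LCopy]) (auto simp: valid_simps simp del: children.simps)
        next
          assume "last p \<in> set ix2"
          then show ?thesis using True k xp s sp in_children_copy[of RCopy p0 k p]
            by (intro exI[of _ RCopy]) (auto simp: valid_simps simp del: children.simps)
        qed
      next
        case sp: False
        then have "p \<in> doubled" using doubled_child True s by blast
        then have k: "k = LCopy \<or> k = RCopy" using x kA unfolding xp by (auto elim!: tag_cases_valid)
        then show ?thesis using True xp s sp in_children_copy[OF k True, of k p]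
          by (intro exI[of _ k]) (auto simp: valid_simps simp del: children.simps)
      qed
    qed
    then obtain k0 where "k0 \<noteq> Added" "(k0, p0) \<in> valid" "x \<in> set (children (k0, p0))" by blast
    then show ?thesis using 2 xp kA by (intro disjI2 bexI[of _ "(k0, p0)"]) auto
  qed
qed (rule assms)

section \<open>The reduced forest and its labelling\<close>

lemma H_not_cut: "p \<in> H \<Longrightarrow> p \<noteq> cut_pos \<and> p \<noteq> sum_pos"
  using cut_notin_H sum_notin_H by blast

lemma contents_copy:
  "k = LCopy \<or> k = RCopy \<Longrightarrow> p \<in> H \<Longrightarrow> node_at G p = Some n \<Longrightarrow> contents (k, p) = map_node (ren k) n"
  using H_not_cut[of p] by (elim disjE) auto

lemma contents_cut:
  "k = LCopy \<or> k = RCopy \<Longrightarrow>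
    contents (k, cut_pos) = NCut (Expansion (map (nth ws) (summands k))) (map_tree (ren k) t)"
  by (elim disjE) auto

lemma contents_sum:
  "k = LCopy \<or> k = RCopy \<Longrightarrow>
    contents (k, sum_pos) = NTree (Expansion (map (nth ws) (summands k)))"
  by (elim disjE) auto

lemma node_at_child: "node_at G p = Some n \<Longrightarrow> i < length (successors n) \<Longrightarrow>
  node_at G (p @ [i]) = Some (successors n ! i)"
  by (cases "p = []") (auto simp: node_at_snoc)

text \<open>
  At the two copies of \<open>s\<close> the summands are found unchanged, because nothing below \<open>s\<close> is duplicated.
\<close>

lemma successors_contents_copy:
  assumes k: "k = LCopy \<or> k = RCopy" and p: "p \<in> doubled"
  shows "successors (contents (k, p)) = map contents (children (k, p))"
proof -
  consider "p = cut_pos" | "p = sum_pos" | "p \<in> H" using p unfolding doubled_def by blast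
  then show ?thesis
  proof cases
    case 1
    have "children (k, p) = map (\<lambda>i. (k, p @ [i])) [0..<arity p]"
      using k 1 by (elim disjE) auto
    also have "[0..<arity p] = [0, 1]"
      unfolding 1 arity_cut by (simp add: numeral_2_eq_2)
    finally have "children (k, p) = [(k, sum_pos), (k, arg_pos)]" by (simp add: 1)
    moreover have "contents (k, arg_pos) = NTree (map_tree (ren k) t)"
      using contents_copy[OF k _ node_at_arg] arg_root by (simp add: roots_def)
    ultimately show ?thesis
      unfolding 1 contents_cut[OF k] by (simp add: contents_sum[OF k] del: contents.simps)
  next
    case 2
    have "children (k, p) = map (\<lambda>i. (Kept, sum_pos @ [i])) (summands k)"
      using k 2 by (elim disjE) auto
    moreover have "contents (Kept, sum_pos @ [i]) = NWit (ws ! i)" if "i \<in> set (summands k)" for i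
    proof -
      have "sum_pos @ [i] @ q \<notin> D" for q using H_avoids_sum[of "[i] @ q"] D_in_H by blast
      then have "dup_wit l r D [length F, 0, i] (ws ! i) = ws ! i"
        by (intro dup_below_id) simp
      then show ?thesis using node_at_summand[OF ix_less[OF k that]] by simp
    qed
    ultimately show ?thesis by (simp only: 2 contents_sum[OF k]) simp
  next
    case 3
    obtain n where n: "node_at G p = Some n" using nodes_D H_nodes 3 by blast
    have "children (k, p) = map (\<lambda>i. (k, p @ [i])) [0..<length (successors n)]"
      using k H_not_cut[OF 3] n by (elim disjE) (auto simp: arity_def)
    moreover have "contents (k, p @ [i]) = map_node (ren k) (successors n ! i)"
      if "i < length (successors n)" for i
    proof (rule contents_copy[OF k])
      have "is_successor G p (p @ [i])" using n that by (auto simp: is_successor_iff)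
      then show "p @ [i] \<in> H" using H_successor 3 by blast
    qed (rule node_at_child[OF n that])
    ultimately have "map contents (children (k, p)) =
        map (\<lambda>i. map_node (ren k) (successors n ! i)) [0..<length (successors n)]"
      by simp
    also have "\<dots> = map (map_node (ren k)) (successors n)"
      by (rule nth_equalityI) auto
    finally show ?thesis using contents_copy[OF k 3 n] successors_map_node by simp
  qed
qed

lemma successors_contents_Kept:
  assumes n: "node_at G p = Some n"
  shows "successors (contents (Kept, p)) = map contents (children (Kept, p))"
proof (cases "\<exists>vs. n = NTree (Expansion vs)")
  case True
  then obtain vs where vs: "n = NTree (Expansion vs)" by blast
  have *: "map contents (copies (p @ [i])) =
      map NWit (if p @ [i] \<in> D then [map_wit l (vs ! i), map_wit r (vs ! i)]
        else [dup_wit l r D (p @ [i]) (vs ! i)])" if "i < length vs" for i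
    using node_at_child[OF n, of i] vs that contents_copy[of LCopy "p @ [i]"]
      contents_copy[of RCopy "p @ [i]"] D_in_H[of "p @ [i]"]
    by (auto simp: copies_def)
  have "successors (contents (Kept, p)) =
      concat (map (\<lambda>i. map NWit (if p @ [i] \<in> D then [map_wit l (vs ! i), map_wit r (vs ! i)]
        else [dup_wit l r D (p @ [i]) (vs ! i)])) [0..<length vs])"
    using n vs by (simp add: dup_sum_eq map_concat comp_def cong: if_cong)
  also have "\<dots> = concat (map (\<lambda>i. map contents (copies (p @ [i]))) [0..<length vs])"
    by (intro arg_cong[of _ _ concat] map_cong refl) (simp only: *[symmetric] set_upt atLeastLessThan_iff)
  finally show ?thesis using n vs by (simp add: arity_def map_concat comp_def)
next
  case False
  have nD: "p @ [i] \<notin> D" if "i < length (successors n)" for i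
    using D_successor[of p "p @ [i]"] False n that by (auto simp: is_successor_iff)
  have "children (Kept, p) = map (\<lambda>i. (Kept, p @ [i])) [0..<length (successors n)]"
  proof -
    have "map (\<lambda>i. copies (p @ [i])) [0..<length (successors n)] =
        map (\<lambda>i. [(Kept, p @ [i])]) [0..<length (successors n)]"
      by (intro map_cong) (use nD in \<open>auto simp: copies_def\<close>)
    then show ?thesis using n by (simp only: children.simps arity_def option.sel concat_map_singleton)
  qed
  moreover have "contents (Kept, p @ [i]) = dup_node (p @ [i]) (successors n ! i)"
      if "i < length (successors n)" for i
    using node_at_child[OF n that] by simp
  moreover have "successors (dup_node p n) = map (\<lambda>i. dup_node (p @ [i]) (successors n ! i)) [0..<length (successors n)]"
    using False by (cases n rule: successors.cases) auto
  ultimately show ?thesis using n by (simp cong: map_cong)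
qed

lemma successors_contents:
  assumes "x \<in> valid"
  shows "successors (contents x) = map contents (children x)"
proof -
  obtain k p where x: "x = (k, p)" by (cases x)
  from assms[unfolded x] show ?thesis
  proof (cases rule: tag_cases_valid)
    case 1
    then show ?thesis unfolding x using nodes_D successors_contents_Kept by blast
  next
    case 2
    then show ?thesis unfolding x using successors_contents_copy by blast
  next
    case 3
    then obtain w where "node_at G p = Some (NWit w)" by blast
    then show ?thesis unfolding x
      using 3 contents_copy[of LCopy p] contents_copy[of RCopy p] D_in_H[of p] by simp
  qed
qed

definition reduct :: "('v, 'a) forest" where
  "reduct = dup_forest l r D F @
    [Cut (Expansion (map (nth ws) ix1)) (map_tree l t),
     Cut (Expansion (map (nth ws) ix2)) (map_tree r t)]"

lemma dup_forest_eq: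
  "dup_forest l r D F = concat (map (\<lambda>i. dup_member l r D i (F ! i)) [0..<length F])"
  unfolding dup_forest_def by (intro arg_cong[of _ _ concat] nth_equalityI) auto

lemma root_nodes_reduct: "map root_node reduct = map contents starts"
proof -
  have "map root_node (dup_member l r D i (F ! i)) = map contents (root_copies [i])"
    if "i < length F" for i
  proof -
    have n: "node_at G [i] = Some (root_node (F ! i))"
      using that by (simp add: node_at_single G_eq nth_append)
    have "[i] \<in> D \<Longrightarrow> contents (LCopy, [i]) = map_node l (root_node (F ! i))"
         "[i] \<in> D \<Longrightarrow> contents (RCopy, [i]) = map_node r (root_node (F ! i))"
      using contents_copy[of LCopy "[i]"] contents_copy[of RCopy "[i]"] n D_in_H by simp_all
    then show ?thesis
      using n D_nodes[of "[i]"] by (cases "F ! i") (auto simp: root_copies_def copies_def)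
  qed
  then have "map (\<lambda>i. map root_node (dup_member l r D i (F ! i))) [0..<length F] =
      map (\<lambda>i. map contents (root_copies [i])) [0..<length F]"
    by (intro map_cong) auto
  then have "map root_node (dup_forest l r D F) =
      map contents (concat (map (\<lambda>i. root_copies [i]) [0..<length F]))"
    unfolding dup_forest_eq map_concat map_map comp_def by (rule arg_cong)
  then show ?thesis by (simp add: reduct_def starts_def)
qed

abbreviation label :: "position \<Rightarrow> tag \<times> position" where
  "label p \<equiv> the (walk children starts p)"

lemma node_at_reduct_eq: "node_at reduct p = map_option contents (walk children starts p)"
  unfolding node_at_def node_in_eq_walk root_nodes_reduct
  by (rule walk_map[where V = valid]) (use starts_valid children_valid successors_contents in auto)

lemma node_at_reduct: "p \<in> nodes reduct \<Longrightarrow> node_at reduct p = Some (contents (label p))"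
  by (auto simp: node_at_reduct_eq nodes_def)

lemma walk_label: "p \<in> nodes reduct \<Longrightarrow> walk children starts p = Some (label p)"
  by (auto simp: node_at_reduct_eq nodes_def)

lemma label_valid: "p \<in> nodes reduct \<Longrightarrow> label p \<in> valid"
  using walk_closed[OF starts_valid children_valid walk_label] .

lemma label_inj: "p \<in> nodes reduct \<Longrightarrow> q \<in> nodes reduct \<Longrightarrow> label p = label q \<Longrightarrow> p = q"
proof (rule walk_inj[where V = valid and z = "label p"])
  show "distinct (children x)" if "x \<in> valid" for x using children_distinct that .
  show "x = y" if "x \<in> valid" "y \<in> valid" "z \<in> set (children x)" "z \<in> set (children y)" for x y z
    using parent_unique that .
  assume "p \<in> nodes reduct" "q \<in> nodes reduct" "label p = label q"
  then show "walk children starts p = Some (label p)" "walk children starts q = Some (label p)"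
    using walk_label[of p] walk_label[of q] by simp_all
qed (use starts_valid children_valid starts_distinct child_not_start in simp_all)

lemma label_surj: "x \<in> valid \<Longrightarrow> \<exists>p \<in> nodes reduct. label p = x"
proof -
  assume "x \<in> valid"
  then obtain p where "walk children starts p = Some x" using valid_reached by blast
  then show ?thesis by (intro bexI[of _ p]) (auto simp: node_at_reduct_eq nodes_def)
qed

lemma label_child:
  assumes "is_successor reduct p q"
  shows "label q \<in> set (children (label p))"
proof -
  obtain i where q: "q = p @ [i]" and n: "p \<in> nodes reduct" "q \<in> nodes reduct"
    using assms by (auto simp: is_successor_def)
  have "p \<noteq> []" using n by (auto simp: nodes_def)
  moreover obtain x y where "walk children starts p = Some x" "walk children starts q = Some y"
    using walk_label n by blast
  ultimately show ?thesis
    using walk_snoc[of p children starts i] q by (auto split: if_splits)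
qed

section \<open>Projection to the given forest\<close>

declare children.simps [simp del] contents.simps [simp del]

abbreviation tag :: "position \<Rightarrow> tag" where "tag p \<equiv> fst (label p)"
abbreviation orig :: "position \<Rightarrow> position" where "orig p \<equiv> snd (label p)"

lemma switched_contents:
  assumes "(k, p) \<in> valid" "k \<noteq> Added"
  shows "is_switched_node (contents (k, p)) \<longleftrightarrow> switched G p"
  using assms(1)
proof (cases rule: tag_cases_valid)
  case 1
  then obtain n where n: "node_at G p = Some n" using nodes_D by blast
  then show ?thesis using 1 by (cases n rule: is_switched_node.cases) (auto simp: switched_iff contents.simps)
next
  case 2
  then consider "p = cut_pos" | "p = sum_pos" | "p \<in> H" unfolding doubled_def by blast
  then show ?thesis
  proof cases
    case 3
    then obtain n where "node_at G p = Some n" using nodes_D H_nodes by blast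
    then show ?thesis using contents_copy[OF 2(1) 3]
      by (simp add: switched_iff is_switched_map_node)
  qed (use contents_cut[OF 2(1)] contents_sum[OF 2(1)] node_at_cut node_at_sum in
      \<open>simp_all add: switched_iff\<close>)
qed (use assms in simp)

lemma switched_reduct:
  assumes "p \<in> nodes reduct" "tag p \<noteq> Added"
  shows "switched reduct p \<longleftrightarrow> switched G (orig p)"
  using switched_contents[of "tag p" "orig p"] label_valid[OF assms(1)] assms
  by (simp add: switched_iff[of reduct] node_at_reduct)

lemma project_successor:
  assumes "is_successor reduct p q" "tag p \<noteq> Added"
  shows "is_successor G (orig p) (orig q)"
proof (rule child_successor)
  show "(tag p, orig p) \<in> valid" using label_valid assms by (simp add: is_successor_def)
  show "(tag q, orig q) \<in> set (children (tag p, orig p))" using label_child assms by simp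
qed (rule assms)

lemma wire_contents:
  assumes "(k, p) \<in> valid"
  shows "contents (k, p) = NWit (Wire y) \<longleftrightarrow>
      k \<noteq> Added \<and> (\<exists>z. node_at G p = Some (NWit (Wire z)) \<and> y = ren k z)"
    and "contents (k, p) = NWit (DWire y) \<longleftrightarrow>
      k \<noteq> Added \<and> (\<exists>z. node_at G p = Some (NWit (DWire z)) \<and> y = ren k z)"
proof -
  have "(contents (k, p) = NWit (Wire y) \<longleftrightarrow>
      k \<noteq> Added \<and> (\<exists>z. node_at G p = Some (NWit (Wire z)) \<and> y = ren k z)) \<and>
    (contents (k, p) = NWit (DWire y) \<longleftrightarrow>
      k \<noteq> Added \<and> (\<exists>z. node_at G p = Some (NWit (DWire z)) \<and> y = ren k z))"
    using assms
  proof (cases rule: tag_cases_valid)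
    case 1
    then obtain n where n: "node_at G p = Some n" using nodes_D by blast
    then show ?thesis using 1 by (cases n rule: successors.cases) (auto simp: contents.simps)
  next
    case 2
    then consider "p = cut_pos" | "p = sum_pos" | "p \<in> H" unfolding doubled_def by blast
    then show ?thesis
    proof cases
      case 3
      then obtain n where n: "node_at G p = Some n" using nodes_D H_nodes by blast
      then show ?thesis unfolding contents_copy[OF 2(1) 3 n] using 2
        by (cases n rule: successors.cases) auto
    qed (use contents_cut[OF 2(1)] contents_sum[OF 2(1)] node_at_cut node_at_sum in
      \<open>simp_all\<close>)
  qed (simp add: contents.simps)
  then show "contents (k, p) = NWit (Wire y) \<longleftrightarrow>
      k \<noteq> Added \<and> (\<exists>z. node_at G p = Some (NWit (Wire z)) \<and> y = ren k z)"
    and "contents (k, p) = NWit (DWire y) \<longleftrightarrow>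
      k \<noteq> Added \<and> (\<exists>z. node_at G p = Some (NWit (DWire z)) \<and> y = ren k z)"
    by blast+
qed

definition is_wire :: "position \<Rightarrow> 'v \<Rightarrow> bool" where
  "is_wire p z \<longleftrightarrow> node_at G p = Some (NWit (Wire z)) \<or> node_at G p = Some (NWit (DWire z))"

text \<open>
  The copies of wire variables are distinct from each other and from all old ones, so a wire variable
  of the reduced forest determines the tag of its occurrence and the variable that it comes from.
\<close>

lemma ren_inj:
  assumes "(k, p) \<in> valid" "(k', p') \<in> valid" "k \<noteq> Added" "k' \<noteq> Added"
    and "is_wire p z" "is_wire p' z'" "ren k z = ren k' z'"
  shows "k = k' \<and> z = z'"
proof -
  have all: "u \<in> wires_in G (nodes G)" if "is_wire q u" for q u
    using that by (auto simp: is_wire_def wires_in_def nodes_def)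
  have inH: "u \<in> wires_in G H" if "is_wire q u" "(j, q) \<in> valid" "j = LCopy \<or> j = RCopy" for j q u
  proof -
    have "q \<in> doubled" using that(2,3) by (auto simp: valid_simps)
    then have "q \<in> H" using that(1) node_at_cut node_at_sum by (auto simp: doubled_def is_wire_def)
    then show ?thesis using that(1) by (auto simp: is_wire_def wires_in_def)
  qed
  note f = fresh[unfolded fresh_copies_def]
  have i: "inj_on l (wires_in G H)" "inj_on r (wires_in G H)" using f by blast+
  have d: "l u \<noteq> r v" if "u \<in> wires_in G H" "v \<in> wires_in G H" for u v using f that by blast
  have e: "l u \<noteq> v" "r u \<noteq> v" if "u \<in> wires_in G H" "v \<in> wires_in G (nodes G)" for u v
    using f that by blast+
  have a: "z \<in> wires_in G (nodes G)" "z' \<in> wires_in G (nodes G)" using all assms by blast+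
  have b: "k = LCopy \<or> k = RCopy \<Longrightarrow> z \<in> wires_in G H" "k' = LCopy \<or> k' = RCopy \<Longrightarrow> z' \<in> wires_in G H"
    using inH assms by blast+
  show ?thesis
    using assms(3,4,7) a b d[of z z'] d[of z' z] e[of z z'] e[of z' z] inj_onD[OF i(1), of z z'] inj_onD[OF i(2), of z z']
    by (cases k; cases k') auto
qed

lemma project_link:
  assumes "axiom_link reduct p q"
  shows "axiom_link G (orig p) (orig q)" "tag p = tag q"
proof -
  obtain x where x: "node_at reduct p = Some (NWit (Wire x))" "node_at reduct q = Some (NWit (DWire x))"
    using assms by (auto simp: axiom_link_def)
  then have pq: "p \<in> nodes reduct" "q \<in> nodes reduct" by (auto simp: nodes_def)
  have v: "(tag p, orig p) \<in> valid" "(tag q, orig q) \<in> valid" using label_valid pq by simp_all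
  have "contents (tag p, orig p) = NWit (Wire x)" "contents (tag q, orig q) = NWit (DWire x)"
    using x node_at_reduct pq by simp_all
  then obtain z z' where z: "tag p \<noteq> Added" "tag q \<noteq> Added" "node_at G (orig p) = Some (NWit (Wire z))"
      "node_at G (orig q) = Some (NWit (DWire z'))" "ren (tag p) z = ren (tag q) z'"
    using wire_contents(1)[OF v(1)] wire_contents(2)[OF v(2)] by metis
  then have "tag p = tag q \<and> z = z'"
    using ren_inj[OF v z(1,2)] by (auto simp: is_wire_def)
  then show "axiom_link G (orig p) (orig q)" "tag p = tag q"
    using z by (auto simp: axiom_link_def)
qed

text \<open>
  On a set of nodes of the reduced forest that contains at most one copy of each node, a switching
  induces a switching of the given forest: a node of the image chooses the projection of the successor
  chosen by its preimage, and all other nodes choose arbitrarily.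
\<close>

lemma project_switching:
  assumes \<sigma>': "is_switching reduct \<sigma>'" and S: "S \<subseteq> nodes reduct" "\<And>p. p \<in> S \<Longrightarrow> tag p \<noteq> Added"
    and inj: "inj_on orig S"
  obtains \<sigma> where "is_switching G \<sigma>"
    "\<And>p q. p \<in> S \<Longrightarrow> q \<in> S \<Longrightarrow> switching_adj reduct \<sigma>' p q \<Longrightarrow> switching_adj G \<sigma> (orig p) (orig q)"
proof -
  define \<sigma> where "\<sigma> u = (if u \<in> orig ` S then orig (\<sigma>' (inv_into S orig u))
    else SOME v. is_successor G u v)" for u
  have \<sigma>_S: "\<sigma> (orig p) = orig (\<sigma>' p)" if "p \<in> S" for p
    using that inv_into_f_f[OF inj that] by (simp add: \<sigma>_def)
  have "is_switching G \<sigma>"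
    unfolding is_switching_def
  proof (intro allI impI)
    fix u assume u: "switched G u"
    show "is_successor G u (\<sigma> u)"
    proof (cases "u \<in> orig ` S")
      case True
      then obtain p where p: "p \<in> S" "u = orig p" by blast
      then have "is_successor reduct p (\<sigma>' p)"
        using u switched_reduct S \<sigma>' by (auto simp: is_switching_def)
      then show ?thesis using project_successor S p \<sigma>_S by simp
    next
      case False
      then show ?thesis
        using switched_has_successor[OF typed u] by (simp add: \<sigma>_def) (metis someI_ex)
    qed
  qed
  moreover have kept: "kept_edge G \<sigma> (orig p) (orig q)"
    if "p \<in> S" "q \<in> S" "kept_edge reduct \<sigma>' p q" for p q
    using that project_successor[of q p] S switched_reduct[of q] \<sigma>_S[of q]
    by (auto simp: kept_edge_def)
  moreover have "switching_adj G \<sigma> (orig p) (orig q)"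
    if "p \<in> S" "q \<in> S" "switching_adj reduct \<sigma>' p q" for p q
    using that kept project_link unfolding switching_adj_def by blast
  ultimately show ?thesis using that by blast
qed

text \<open>
  A node of the given forest is either kept or doubled, and the tag and the projection determine a node
  of the reduced forest.
\<close>

lemma orig_eqD:
  assumes "p \<in> nodes reduct" "q \<in> nodes reduct" "tag p \<noteq> Added" "tag q \<noteq> Added" "orig p = orig q"
  shows "p = q \<or> tag p = LCopy \<and> tag q = RCopy \<or> tag p = RCopy \<and> tag q = LCopy"
proof (cases "tag p = tag q")
  case True
  then show ?thesis using label_inj assms by (simp add: prod_eq_iff)
next
  case False
  have v: "(tag p, orig p) \<in> valid" "(tag q, orig q) \<in> valid"
    using label_valid[OF assms(1)] label_valid[OF assms(2)] by simp_all
  show ?thesis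
    using v False assms(3-5) by (cases "tag p"; cases "tag q") (auto simp: valid_simps)
qed

lemma copy_orig: "p \<in> nodes reduct \<Longrightarrow> tag p = LCopy \<or> tag p = RCopy \<Longrightarrow> orig p \<in> doubled"
  using label_valid[of p] by (cases "label p") (auto simp: valid_simps)

lemma Kept_orig: "p \<in> nodes reduct \<Longrightarrow> tag p = Kept \<Longrightarrow> orig p \<in> nodes G \<and> orig p \<notin> doubled"
  using label_valid[of p] by (cases "label p") (auto simp: valid_simps)

text \<open>
  An added expansion is a root, so in a switching graph its only neighbour is the chosen summand.
\<close>

lemma Added_neighbour:
  assumes "tag p = Added" "switching_adj reduct \<sigma>' p q"
  shows "q = \<sigma>' p"
proof -
  have p: "p \<in> nodes reduct" using switching_adj_nodes assms by blast
  have lab: "label p = (Added, orig p)" using assms(1) by (metis prod.collapse)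
  have c: "node_at reduct p = Some (contents (Added, orig p))"
    using node_at_reduct[OF p] lab by simp
  then have sw: "switched reduct p" by (simp add: switched_iff contents.simps)
  have "\<not> kept_edge reduct \<sigma>' p q"
  proof
    assume "kept_edge reduct \<sigma>' p q"
    then have s: "is_successor reduct q p" by (simp add: kept_edge_def)
    then have "label q \<in> valid" using label_valid by (simp add: is_successor_def)
    moreover have "(Added, orig p) \<in> set (children (label q))"
      using label_child[OF s] lab by simp
    ultimately show False using Added_not_child by blast
  qed
  moreover have "\<not> axiom_link reduct p q" "\<not> axiom_link reduct q p"
    using c by (auto simp: axiom_link_def contents.simps)
  ultimately have "kept_edge reduct \<sigma>' q p" using assms(2) by (auto simp: switching_adj_def)
  then show ?thesis using sw by (simp add: kept_edge_def)
qed

lemma copies_adjacent: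
  assumes "switching_adj reduct \<sigma>' p q" "tag p = LCopy \<or> tag p = RCopy" "tag q = LCopy \<or> tag q = RCopy"
  shows "tag p = tag q"
proof -
  have *: "tag p = tag q" if "is_successor reduct p q" "tag p = LCopy \<or> tag p = RCopy" "tag q = LCopy \<or> tag q = RCopy" for p q
  proof -
    have "orig p \<in> doubled" using copy_orig that by (simp add: is_successor_def)
    then show ?thesis
      using in_children_copy[OF that(2), of "orig p" "tag q" "orig q"] label_child[OF that(1)] that(3)
      by (auto split: if_splits)
  qed
  show ?thesis
    using assms *[of p q] *[of q p] project_link(2)[of p q] project_link(2)[of q p]
    unfolding switching_adj_def kept_edge_def by metis
qed

text \<open>
  The two exits of a copy: from a root in \<open>D\<close> up to the expansion of which it is a chosen summand, or from
  \<open>s\<close> down to its chosen summand.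
\<close>

lemma leaving_copy:
  assumes "switching_adj reduct \<sigma>' p q" "tag p = LCopy \<or> tag p = RCopy" "tag q = Kept"
  shows "orig p \<in> D \<and> is_successor G (orig q) (orig p) \<and> p = \<sigma>' q \<or> orig p = sum_pos \<and> q = \<sigma>' p"
proof -
  have n: "p \<in> nodes reduct" "q \<in> nodes reduct" using switching_adj_nodes assms(1) by blast+
  have q: "orig q \<in> nodes G" "orig q \<notin> doubled" "label q = (Kept, orig q)"
    using Kept_orig n assms(3) by (auto simp: prod_eq_iff)
  have p: "orig p \<in> doubled" using copy_orig n assms(2) by blast
  consider "kept_edge reduct \<sigma>' p q" | "kept_edge reduct \<sigma>' q p"
    using assms project_link(2)[of p q] project_link(2)[of q p] unfolding switching_adj_def by auto
  then show ?thesis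
  proof cases
    case 1
    then have s: "is_successor reduct q p" by (simp add: kept_edge_def)
    have "(tag p, orig p) \<in> set (children (Kept, orig q))" using label_child[OF s] q by simp
    then have *: "is_successor G (orig q) (orig p)" "orig p \<in> D"
      using in_children_Kept[OF q(1), of "tag p" "orig p"] assms(2) by (auto split: if_splits)
    then have "switched G (orig q)" using D_successor by (metis switched_def)
    then have "switched reduct q" using switched_reduct n assms(3) by simp
    then show ?thesis using 1 * by (simp add: kept_edge_def)
  next
    case 2
    then have s: "is_successor reduct p q" by (simp add: kept_edge_def)
    have "(Kept, orig q) \<in> set (children (tag p, orig p))" using label_child[OF s] q(3) by simp
    then have *: "orig p = sum_pos"
      using in_children_copy[OF assms(2) p, of Kept "orig q"] assms(2) by (auto split: if_splits)
    then have "switched G (orig p)" using node_at_sum by (auto simp: switched_iff)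
    then have "switched reduct p" using switched_reduct n assms(2) by auto
    then show ?thesis using 2 * by (simp add: kept_edge_def)
  qed
qed

section \<open>Correctness of the reduced forest\<close>

lemma subnet_path:
  "switching_path G ps \<Longrightarrow> hd ps \<in> roots G H \<Longrightarrow> last ps \<in> roots G H \<Longrightarrow> set ps \<subseteq> H"
  using subnet unfolding subnet_def by blast

text \<open>
  A path from one copy of the doubled part to the other through kept nodes cannot end in a copy of a
  root in \<open>D\<close>: it would project to a switching path between two roots of \<open>H\<close> that leaves \<open>H\<close>. If the path
  begins at \<open>s\<close> instead of a root, the projection is prolonged from \<open>s\<close> through the cut to the root \<open>t\<close>.
\<close>

lemma no_detour:
  assumes \<sigma>': "is_switching reduct \<sigma>'"
    and path: "successively (switching_adj reduct \<sigma>') (a # os @ [b])" "distinct (a # os @ [b])"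
    and tags: "tag a = LCopy \<and> tag b = RCopy \<or> tag a = RCopy \<and> tag b = LCopy"
    and os: "\<And>u. u \<in> set os \<Longrightarrow> tag u = Kept"
  shows "orig b \<notin> D"
proof
  assume bD: "orig b \<in> D"
  have "os \<noteq> []" using path(1) tags copies_adjacent[of \<sigma>' a b] by auto
  define c d where "c = hd os" and "d = last os"
  have cd: "c \<in> set os" "d \<in> set os" using \<open>os \<noteq> []\<close> by (simp_all add: c_def d_def)
  have adj: "switching_adj reduct \<sigma>' a c" "switching_adj reduct \<sigma>' b d"
    using path(1) \<open>os \<noteq> []\<close> switching_adj_sym[of reduct \<sigma>']
    by (auto simp: c_def d_def successively_Cons successively_append_iff hd_append)
  have "u \<in> nodes reduct" if u: "u \<in> set os" for u
  proof -
    obtain xs ys where "os = xs @ u # ys" using split_list[OF u] by blast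
    then have "switching_adj reduct \<sigma>' u (hd (ys @ [b]))"
      using path(1) by (cases ys) (auto simp: successively_Cons successively_append_iff)
    then show ?thesis using switching_adj_nodes by blast
  qed
  moreover have "a \<in> nodes reduct" "b \<in> nodes reduct" using adj switching_adj_nodes by blast+
  ultimately have nodes: "set (a # os @ [b]) \<subseteq> nodes reduct" by auto
  have osK: "orig u \<notin> doubled" if "u \<in> set os" for u using Kept_orig os nodes that by auto
  have bd: "is_successor G (orig d) (orig b)" "b = \<sigma>' d"
    using leaving_copy[OF adj(2)] tags os[OF cd(2)] bD sum_notin_H D_in_H by auto
  \<comment> \<open>Two copies of the same root are summands of one expansion, which keeps only one of them.\<close>
  have "orig a \<noteq> orig b"
  proof
    assume eq: "orig a = orig b"
    then have ac: "is_successor G (orig c) (orig a)" "a = \<sigma>' c"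
      using leaving_copy[OF adj(1)] tags os[OF cd(1)] bD sum_notin_H D_in_H by auto
    then have "orig c = orig d" using bd eq is_successor_unique by simp
    then have "c = d" using orig_eqD[of c d] nodes cd os by auto
    then show False using ac bd tags by auto
  qed
  define S where "S = set (a # os @ [b])"
  have tS: "tag p \<noteq> Added" if "p \<in> S" for p using that os tags by (auto simp: S_def)
  have inj: "inj_on orig S"
  proof (rule inj_onI)
    fix u v assume uv: "u \<in> S" "v \<in> S" "orig u = orig v"
    have "u = v \<or> tag u = LCopy \<and> tag v = RCopy \<or> tag u = RCopy \<and> tag v = LCopy"
      using orig_eqD[of u v] uv nodes tS by (auto simp: S_def)
    moreover have end_point: "u = a \<or> u = b" if "tag u = LCopy \<or> tag u = RCopy" "u \<in> S" for u
      using that os by (auto simp: S_def)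
    ultimately show "u = v"
      using end_point[of u] end_point[of v] uv \<open>orig a \<noteq> orig b\<close> tags by metis
  qed
  obtain \<sigma> where \<sigma>: "is_switching G \<sigma>"
    "\<And>p q. p \<in> S \<Longrightarrow> q \<in> S \<Longrightarrow> switching_adj reduct \<sigma>' p q \<Longrightarrow> switching_adj G \<sigma> (orig p) (orig q)"
    using project_switching[OF \<sigma>' _ tS inj] nodes S_def by blast
  let ?ps = "map orig (a # os @ [b])"
  have s: "successively (switching_adj G \<sigma>) ?ps"
    unfolding successively_map
    by (rule successively_mono[OF path(1)]) (use \<sigma>(2) in \<open>auto simp: S_def\<close>)
  have dist: "distinct ?ps" using path(2) inj unfolding distinct_map S_def by blast
  have ons: "orig p \<in> nodes G" if "p \<in> S" for p
    using that copy_orig[of p] Kept_orig[of p] doubled_nodes nodes tags os by (auto simp: S_def)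
  have bR: "orig b \<in> roots G H" using bD by (simp add: D_eq)
  have "orig c \<in> H"
  proof (cases "orig a = sum_pos")
    case False
    then have "orig a \<in> D" using leaving_copy[OF adj(1)] tags os[OF cd(1)] by auto
    then have aR: "orig a \<in> roots G H" by (simp add: D_eq)
    have "switching_path G ?ps"
      unfolding switching_path_def using \<sigma>(1) s dist ons by (auto simp: S_def)
    moreover have "hd ?ps \<in> roots G H" "last ?ps \<in> roots G H" using aR bR by simp_all
    ultimately have "set ?ps \<subseteq> H" by (rule subnet_path)
    then show ?thesis using cd by auto
  next
    case True
    \<comment> \<open>The cut is unswitched, so these edges are present in each switching graph.\<close>
    let ?qs = "arg_pos # cut_pos # ?ps"
    have "kept_edge G \<sigma> arg_pos cut_pos" "kept_edge G \<sigma> sum_pos cut_pos"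
      using cut_successors cut_not_switched by (auto simp: kept_edge_def)
    then have "successively (switching_adj G \<sigma>) ?qs"
      using s True by (auto simp: switching_adj_def)
    moreover have "distinct ?qs"
    proof -
      have "arg_pos \<in> doubled" "cut_pos \<in> doubled" using arg_root by (auto simp: doubled_def roots_def)
      moreover have "orig b \<noteq> arg_pos" "orig b \<noteq> cut_pos"
        using bD cut_notin_H D_in_H by (auto simp: D_eq)
      ultimately show ?thesis using dist osK True by auto
    qed
    moreover have "set ?qs \<subseteq> nodes G"
      using ons cut_successors by (auto simp: S_def is_successor_def)
    ultimately have "switching_path G ?qs" using \<sigma>(1) by (auto simp: switching_path_def)
    moreover have "hd ?qs \<in> roots G H" "last ?qs \<in> roots G H" using arg_root bR by simp_all
    ultimately have "set ?qs \<subseteq> H" by (rule subnet_path)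
    then show ?thesis using cut_notin_H by auto
  qed
  then show False using osK[OF cd(1)] by (simp add: doubled_def)
qed

text \<open>
  Between the first right copy and the last left copy before it the path runs through kept nodes. By
  \<open>no_detour\<close>, applied to the reversed segment, the segment does not leave at a root in \<open>D\<close>; so it leaves
  at \<open>s\<close>.
\<close>

lemma crossing_arc:
  assumes \<sigma>': "is_switching reduct \<sigma>'"
    and path: "successively (switching_adj reduct \<sigma>') ps" "distinct ps" "ps \<noteq> []"
    and noA: "\<And>u. u \<in> set ps \<Longrightarrow> tag u \<noteq> Added"
    and tags: "tag (hd ps) = LCopy" "tag (last ps) = RCopy"
  shows "\<exists>a\<in>set ps. tag a = LCopy \<and> orig a = sum_pos \<and> \<sigma>' a \<in> set ps \<and> tag (\<sigma>' a) = Kept"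
proof -
  have ex: "\<exists>us a os b ws. ps = us @ a # os @ b # ws \<and> tag a = LCopy \<and> tag b = RCopy \<and>
      (\<forall>v\<in>set os. tag v \<noteq> LCopy \<and> tag v \<noteq> RCopy)"
    by (rule split_between[where P = "\<lambda>u. tag u = LCopy" and Q = "\<lambda>u. tag u = RCopy"])
      (use assms in auto)
  then obtain us a os b ws where ps: "ps = us @ a # os @ b # ws" and ab: "tag a = LCopy" "tag b = RCopy"
    and nos: "\<forall>v\<in>set os. tag v \<noteq> LCopy \<and> tag v \<noteq> RCopy" by blast
  have os: "tag u = Kept" if "u \<in> set os" for u
    using nos noA[of u] that ps by (cases "tag u") auto
  have p: "successively (switching_adj reduct \<sigma>') (a # os @ [b])" "distinct (a # os @ [b])"
    using path(1,2) unfolding ps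
    by (auto simp: successively_Cons successively_append_iff hd_append split: if_splits)
  have "successively (switching_adj reduct \<sigma>') (rev (a # os @ [b]))"
    unfolding successively_switching_adj_rev by (rule p)
  then have "orig a \<notin> D" using no_detour[OF \<sigma>', of b "rev os" a] p(2) ab os by auto
  moreover have ne: "os \<noteq> []" using p(1) ab copies_adjacent[of \<sigma>' a b] by auto
  then have "switching_adj reduct \<sigma>' a (hd os)" "hd os \<in> set os"
    using p(1) by (auto simp: successively_Cons hd_append)
  ultimately have a: "orig a = sum_pos" "hd os = \<sigma>' a"
    using leaving_copy[of \<sigma>' a "hd os"] ab os by blast+
  have "\<sigma>' a \<in> set os" using ne unfolding a(2)[symmetric] by simp
  then show ?thesis using ab os[of "\<sigma>' a"] a(1) unfolding ps by (intro bexI[of _ a]) auto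
qed

lemma AC_reduct:
  assumes AC: "AC_correct G"
  shows "AC_correct reduct"
  unfolding AC_correct_def
proof (intro allI impI notI)
  fix \<sigma>' assume \<sigma>': "is_switching reduct \<sigma>'" and "\<exists>ps. switching_cycle reduct \<sigma>' ps"
  then obtain ps where ps: "switching_cycle reduct \<sigma>' ps" by blast
  have nodes: "set ps \<subseteq> nodes reduct" using switching_cycle_nodes ps by blast
  have noA: "tag p \<noteq> Added" if p: "p \<in> set ps" for p
  proof
    assume A: "tag p = Added"
    obtain qs where qs: "switching_cycle reduct \<sigma>' (p # qs)"
      using switching_cycle_rotate[OF ps p] by blast
    then obtain q qs' where q: "qs = q # qs'" "qs' \<noteq> []"
      by (cases qs; cases "tl qs") (auto simp: switching_cycle_def)
    have "switching_adj reduct \<sigma>' p q" "switching_adj reduct \<sigma>' p (last qs')" "q \<noteq> last qs'"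
      using qs q switching_adj_sym[of reduct \<sigma>'] by (auto simp: switching_cycle_def)
    then show False
      using Added_neighbour[OF A, of \<sigma>' q] Added_neighbour[OF A, of \<sigma>' "last qs'"] by simp
  qed
  show False
  proof (cases "inj_on orig (set ps)")
    case True
    obtain \<sigma> where \<sigma>: "is_switching G \<sigma>"
      "\<And>p q. p \<in> set ps \<Longrightarrow> q \<in> set ps \<Longrightarrow> switching_adj reduct \<sigma>' p q \<Longrightarrow>
        switching_adj G \<sigma> (orig p) (orig q)"
      using project_switching[OF \<sigma>' nodes noA True] by blast
    have "successively (switching_adj G \<sigma>) (map orig ps)"
      unfolding successively_map
      by (rule successively_mono[where P = "switching_adj reduct \<sigma>'"])
        (use \<sigma>(2) ps in \<open>auto simp: switching_cycle_def\<close>)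
    moreover have "ps \<noteq> []" using ps by (auto simp: switching_cycle_def)
    then have "switching_adj G \<sigma> (last (map orig ps)) (hd (map orig ps))"
      using \<sigma>(2)[of "last ps" "hd ps"] ps by (simp add: switching_cycle_def last_map hd_map)
    ultimately have "switching_cycle G \<sigma> (map orig ps)"
      using ps True unfolding switching_cycle_def distinct_map by simp
    then show False using AC \<sigma>(1) by (auto simp: AC_correct_def)
  next
    case False
    then obtain p q where pq: "p \<in> set ps" "q \<in> set ps" "orig p = orig q" "p \<noteq> q"
      by (auto simp: inj_on_def)
    then have "tag p = LCopy \<and> tag q = RCopy \<or> tag p = RCopy \<and> tag q = LCopy"
      using orig_eqD[of p q] nodes noA by blast
    then obtain a b where ab: "a \<in> set ps" "b \<in> set ps" "tag a = LCopy" "tag b = RCopy"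
      using pq by blast
    obtain qs where qs: "switching_cycle reduct \<sigma>' (a # qs)" "set (a # qs) = set ps"
      using switching_cycle_rotate[OF ps ab(1)] by blast
    have "a \<noteq> b" using ab by auto
    then have "b \<in> set qs" using ab(2) unfolding qs(2)[symmetric] by simp
    then obtain us vs where uvs: "qs = us @ b # vs" using split_list by metis
    \<comment> \<open>The two arcs of the cycle between \<open>a\<close> and \<open>b\<close>.\<close>
    have s: "successively (switching_adj reduct \<sigma>') (a # us @ [b])"
      "successively (switching_adj reduct \<sigma>') (b # vs @ [a])" and d: "distinct (a # us @ b # vs)"
      using qs(1) unfolding uvs switching_cycle_def
      by (auto simp: successively_Cons successively_append_iff hd_append split: if_splits)
    from s(2) have s': "successively (switching_adj reduct \<sigma>') (a # rev vs @ [b])"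
      using successively_switching_adj_rev[of reduct \<sigma>' "b # vs @ [a]"] by simp
    have t: "tag u \<noteq> Added" if "u \<in> {a, b} \<union> set us \<union> set vs" for u
      using noA qs(2) that unfolding uvs by auto
    obtain c where c: "c \<in> set (a # us @ [b])" "tag c = LCopy" "orig c = sum_pos"
        "\<sigma>' c \<in> set (a # us @ [b])" "tag (\<sigma>' c) = Kept"
      using crossing_arc[OF \<sigma>' s(1)] d t ab by auto
    obtain c' where c': "c' \<in> set (a # rev vs @ [b])" "tag c' = LCopy" "orig c' = sum_pos"
        "\<sigma>' c' \<in> set (a # rev vs @ [b])" "tag (\<sigma>' c') = Kept"
      using crossing_arc[OF \<sigma>' s'] d t ab by auto
    \<comment> \<open>Both are the left copy of \<open>s\<close>; thus its chosen summand lies on both arcs, hence is one of their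
       common end points, but it is not a copy.\<close>
    have "c \<in> nodes reduct" "c' \<in> nodes reduct"
      using c(1) c'(1) nodes unfolding qs(2)[symmetric] uvs by auto
    then have "c = c'" using label_inj c c' by (simp add: prod_eq_iff)
    then have "\<sigma>' c \<in> {a, b}" using c c' d by auto
    then show False using c(5) ab by auto
  qed
qed

section \<open>Typing of the reduced forest\<close>

lemma wires_in_all: "node_at G p = Some n \<Longrightarrow> node_wires n \<subseteq> wires_in G (nodes G)"
  using node_wires_position[of G p n] by (fastforce simp: wires_in_def nodes_def)

lemma wires_in_H: "node_at G p = Some n \<Longrightarrow> p \<in> H \<Longrightarrow> node_wires n \<subseteq> wires_in G H"
proof
  fix x assume *: "node_at G p = Some n" "p \<in> H" "x \<in> node_wires n"
  then obtain q where q: "node_at G (p @ q) = Some (NWit (Wire x)) \<or> node_at G (p @ q) = Some (NWit (DWire x))"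
    using node_wires_position[of G p n x] by metis
  then have "p @ q \<in> nodes G" by (auto simp: nodes_def)
  then have "p @ q \<in> H" by (rule H_extend[OF *(2)])
  then show "x \<in> wires_in G H" using q unfolding wires_in_def by blast
qed

text \<open>
  The copies of a wire variable carry the same proposition symbol as the variable itself.
\<close>

definition copy_typing :: "('v \<Rightarrow> 'a) \<Rightarrow> 'v \<Rightarrow> 'a" where
  "copy_typing \<tau> x =
    (if x \<in> l ` wires_in G H then \<tau> (inv_into (wires_in G H) l x)
     else if x \<in> r ` wires_in G H then \<tau> (inv_into (wires_in G H) r x) else \<tau> x)"

lemma copy_typing:
  "x \<in> wires_in G H \<Longrightarrow> copy_typing \<tau> (l x) = \<tau> x"
  "x \<in> wires_in G H \<Longrightarrow> copy_typing \<tau> (r x) = \<tau> x"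
  "x \<in> wires_in G (nodes G) \<Longrightarrow> copy_typing \<tau> x = \<tau> x"
proof -
  note f = fresh[unfolded fresh_copies_def]
  have i: "inj_on l (wires_in G H)" "inj_on r (wires_in G H)" using f by blast+
  show "x \<in> wires_in G H \<Longrightarrow> copy_typing \<tau> (l x) = \<tau> x"
    using inv_into_f_f[OF i(1)] by (simp add: copy_typing_def)
  assume *: "x \<in> wires_in G H"
  then have "r x \<notin> l ` wires_in G H" using f by blast
  then show "copy_typing \<tau> (r x) = \<tau> x"
    using * inv_into_f_f[OF i(2)] by (simp add: copy_typing_def)
next
  assume "x \<in> wires_in G (nodes G)"
  then have "x \<notin> l ` wires_in G H" "x \<notin> r ` wires_in G H"
    using fresh unfolding fresh_copies_def by blast+
  then show "copy_typing \<tau> x = \<tau> x" by (simp add: copy_typing_def)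
qed

lemma typed_copy:
  assumes "p \<in> H"
  shows "node_at G p = Some (NTree u) \<Longrightarrow> typed_tree \<tau> u A \<Longrightarrow>
      typed_tree (copy_typing \<tau>) (map_tree l u) A \<and> typed_tree (copy_typing \<tau>) (map_tree r u) A"
    and "node_at G p = Some (NWit w) \<Longrightarrow> typed_wit \<tau> w P \<Longrightarrow>
      typed_wit (copy_typing \<tau>) (map_wit l w) P \<and> typed_wit (copy_typing \<tau>) (map_wit r w) P"
proof -
  assume *: "node_at G p = Some (NTree u)" "typed_tree \<tau> u A"
  have "set_tree u \<subseteq> wires_in G H" using wires_in_H[OF *(1) assms] by simp
  then have "\<forall>x\<in>set_tree u. copy_typing \<tau> (l x) = \<tau> x" "\<forall>x\<in>set_tree u. copy_typing \<tau> (r x) = \<tau> x"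
    using copy_typing(1,2) by blast+
  then show "typed_tree (copy_typing \<tau>) (map_tree l u) A \<and> typed_tree (copy_typing \<tau>) (map_tree r u) A"
    using typed_map(1)[OF *(2)] by blast
next
  assume *: "node_at G p = Some (NWit w)" "typed_wit \<tau> w P"
  have "set_wit w \<subseteq> wires_in G H" using wires_in_H[OF *(1) assms] by simp
  then have "\<forall>x\<in>set_wit w. copy_typing \<tau> (l x) = \<tau> x" "\<forall>x\<in>set_wit w. copy_typing \<tau> (r x) = \<tau> x"
    using copy_typing(1,2) by blast+
  then show "typed_wit (copy_typing \<tau>) (map_wit l w) P \<and> typed_wit (copy_typing \<tau>) (map_wit r w) P"
    using typed_map(2)[OF *(2)] by blast
qed

text \<open>
  An expansion stays well typed because the copies of a summand have the type of that summand.
\<close>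

lemma typed_dup:
  "node_at G p = Some (NTree u) \<Longrightarrow> typed_tree \<tau> u A \<Longrightarrow>
    typed_tree (copy_typing \<tau>) (dup_tree l r D p u) A"
  "node_at G p = Some (NWit w) \<Longrightarrow> typed_wit \<tau> w P \<Longrightarrow>
    typed_wit (copy_typing \<tau>) (dup_wit l r D p w) P"
proof (induction u and w arbitrary: p A and p P)
  case One
  then show ?case using typed_cong(1)[OF One(2)] by simp
next
  case (Expansion vs)
  obtain P where P: "vs \<noteq> []" "\<And>w. w \<in> set vs \<Longrightarrow> typed_wit \<tau> w P" "A = underlying P"
    using Expansion.prems(2) by (auto elim: typed_tree.cases)
  have n: "node_at G (p @ [j]) = Some (NWit (vs ! j))" if "j < length vs" for j
    using node_at_child[OF Expansion.prems(1), of j] that by simp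
  have "typed_wit (copy_typing \<tau>) w P" if "w \<in> set (dup_sum l r D p 0 vs)" for w
  proof -
    have "\<exists>j\<in>{0..<length vs}. w \<in> set (if p @ [j] \<in> D then [map_wit l (vs ! j), map_wit r (vs ! j)]
        else [dup_wit l r D (p @ [j]) (vs ! j)])"
      using that unfolding dup_sum_eq set_concat set_map set_upt image_image UN_iff add_0 .
    then obtain j where "j \<in> {0..<length vs}"
      and w: "w \<in> set (if p @ [j] \<in> D then [map_wit l (vs ! j), map_wit r (vs ! j)]
        else [dup_wit l r D (p @ [j]) (vs ! j)])"
      by (rule bexE)
    then have j: "j < length vs" by simp
    have v: "vs ! j \<in> set vs" using j by simp
    show ?thesis
    proof (cases "p @ [j] \<in> D")
      case True
      then show ?thesis using w typed_copy(2)[OF D_in_H[OF True] n[OF j] P(2)[OF v]] by auto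
    next
      case False
      then show ?thesis using w Expansion.IH[OF v n[OF j] P(2)[OF v]] by simp
    qed
  qed
  moreover have "dup_sum l r D p 0 vs \<noteq> []" using P(1) by (cases vs) auto
  ultimately show ?case using P(3) by (auto intro: typed_tree_typed_wit.intros)
next
  case (Or u v)
  then obtain B C where "A = Disj B C" "typed_tree \<tau> u B" "typed_tree \<tau> v C"
    by (auto elim: typed_tree.cases)
  then show ?case
    using Or.IH node_at_child[OF Or.prems(1), of 0] node_at_child[OF Or.prems(1), of 1]
    by (auto intro!: typed_tree_typed_wit.intros)
next
  case (OrL u)
  then obtain B C where "A = Disj B C" "typed_tree \<tau> u B"
    by (auto elim: typed_tree.cases)
  then show ?case
    using OrL.IH node_at_child[OF OrL.prems(1), of 0]
    by (auto intro!: typed_tree_typed_wit.intros)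
next
  case (OrR u)
  then obtain B C where "A = Disj B C" "typed_tree \<tau> u C"
    by (auto elim: typed_tree.cases)
  then show ?case
    using OrR.IH node_at_child[OF OrR.prems(1), of 1]
    by (auto intro!: typed_tree_typed_wit.intros)
next
  case (Wire x)
  then show ?case using wires_in_all[OF Wire(1)] copy_typing(3) typed_cong(2)[OF Wire(2)] by auto
next
  case (DWire x)
  then show ?case using wires_in_all[OF DWire(1)] copy_typing(3) typed_cong(2)[OF DWire(2)] by auto
next
  case (Tensor u v)
  then obtain B C where "P = WTensor B C" "typed_tree \<tau> u B" "typed_tree \<tau> v C"
    by (auto elim: typed_wit.cases)
  then show ?case
    using Tensor.IH node_at_child[OF Tensor.prems(1), of 0] node_at_child[OF Tensor.prems(1), of 1]
    by (auto intro!: typed_tree_typed_wit.intros)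
qed

text \<open>
  Linearity of the wire variables follows from \<open>ren_inj\<close>, as a wire variable determines the label of its
  node. The dual of a variable is present because \<open>H\<close> is closed under axiom links: the dual node of the
  given forest is valid under the same tag, so it is a label of some node of the reduced forest.
\<close>

lemma typed_reduct:
  assumes nonempty: "ix1 \<noteq> []" "ix2 \<noteq> []"
  shows "typed_forest reduct"
proof -
  obtain \<tau> where \<tau>: "\<forall>m\<in>set G. typed_member \<tau> m" using typed by (auto simp: typed_forest_def)
  let ?\<tau> = "copy_typing \<tau>"
  have old: "typed_member ?\<tau> m" if i: "i < length F" and m: "m \<in> set (dup_member l r D i (F ! i))" for i m
  proof -
    have n: "node_at G [i] = Some (root_node (F ! i))"
      using i by (simp add: node_at_single G_eq nth_append)
    have t: "typed_member \<tau> (F ! i)" using \<tau> i by (simp add: G_eq)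
    show ?thesis
    proof (cases "F ! i")
      case (TreeRoot u A)
      then show ?thesis using m n t typed_dup(1) by simp
    next
      case (WitRoot w P)
      show ?thesis
      proof (cases "[i] \<in> D")
        case True
        then show ?thesis using m n t WitRoot typed_copy(2)[OF D_in_H[OF True], of w \<tau> P]
          by (auto intro!: typed_tree_typed_wit.intros)
      next
        case False
        then show ?thesis using m n t WitRoot typed_dup(2) by simp
      qed
    next
      case (Cut u v)
      then obtain A where A: "A \<noteq> Top" "A \<noteq> Bot" "typed_tree \<tau> u A" "typed_tree \<tau> v (dual A)"
        using t by auto
      have c: "node_at G [i, 0] = Some (NTree u)" "node_at G [i, 1] = Some (NTree v)"
        using node_at_child[OF n, of 0] node_at_child[OF n, of 1] Cut by simp_all
      show ?thesis
      proof (cases "[i] \<in> D")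
        case True
        then have "[i, 0] \<in> H" "[i, 1] \<in> H"
          using H_extend[of "[i]" "[0]"] H_extend[of "[i]" "[1]"] D_in_H c by (auto simp: nodes_def)
        then have "typed_tree ?\<tau> (map_tree l u) A" "typed_tree ?\<tau> (map_tree r u) A"
            "typed_tree ?\<tau> (map_tree l v) (dual A)" "typed_tree ?\<tau> (map_tree r v) (dual A)"
          using typed_copy(1) c A by blast+
        then show ?thesis using m A(1,2) True Cut by auto
      next
        case False
        have "typed_tree ?\<tau> (dup_tree l r D [i, 0] u) A" "typed_tree ?\<tau> (dup_tree l r D [i, 1] v) (dual A)"
          using typed_dup(1) c A by blast+
        then show ?thesis using m A(1,2) False Cut by auto
      qed
    qed
  qed
  have "typed_member \<tau> (Cut (Expansion ws) t)" using \<tau> by (simp add: G_eq)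
  then obtain A where A: "A \<noteq> Top" "A \<noteq> Bot" "typed_tree \<tau> (Expansion ws) A" "typed_tree \<tau> t (dual A)"
    by auto
  obtain P where P: "\<And>w. w \<in> set ws \<Longrightarrow> typed_wit \<tau> w P" "A = underlying P"
    using A(3) by (auto elim: typed_tree.cases)
  have P': "typed_wit ?\<tau> (ws ! i) P" if "i < length ws" for i
    using wires_in_all[OF node_at_summand[OF that]] copy_typing(3) typed_cong(2)[OF P(1)] that
    by (metis node_wires.simps(2) nth_mem subsetD)
  have "typed_tree ?\<tau> (Expansion (map (nth ws) (summands k))) A" if "k = LCopy \<or> k = RCopy" for k
    unfolding P(2) using that nonempty ix_less[OF that] P'
    by (intro typed_tree_typed_wit.intros(2)) auto
  from this[of LCopy] this[of RCopy]
  have s: "typed_tree ?\<tau> (Expansion (map (nth ws) ix1)) A" "typed_tree ?\<tau> (Expansion (map (nth ws) ix2)) A"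
    by simp_all
  have "arg_pos \<in> H" using arg_root by (simp add: roots_def)
  then have "typed_tree ?\<tau> (map_tree l t) (dual A)" "typed_tree ?\<tau> (map_tree r t) (dual A)"
    using typed_copy(1) node_at_arg A(4) by blast+
  then have typed': "\<forall>m\<in>set reduct. typed_member ?\<tau> m"
    using old s A(1,2) by (auto simp: reduct_def dup_forest_eq)
  have lab: "(tag p, orig p) \<in> valid" "node_at reduct p = Some (contents (tag p, orig p))"
    if "node_at reduct p = Some n" for p n
    using that label_valid[of p] node_at_reduct[of p] by (auto simp: nodes_def)
  have W: "\<exists>z. tag p \<noteq> Added \<and> node_at G (orig p) = Some (NWit (Wire z)) \<and> x = ren (tag p) z"
    if "node_at reduct p = Some (NWit (Wire x))" for p x
    using that lab[OF that] wire_contents(1)[of "tag p" "orig p" x] by auto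
  have DW: "\<exists>z. tag p \<noteq> Added \<and> node_at G (orig p) = Some (NWit (DWire z)) \<and> x = ren (tag p) z"
    if "node_at reduct p = Some (NWit (DWire x))" for p x
    using that lab[OF that] wire_contents(2)[of "tag p" "orig p" x] by auto
  have uniqW: "p = q" if pq: "node_at reduct p = Some (NWit (Wire x))" "node_at reduct q = Some (NWit (Wire x))" for x p q
  proof -
    obtain z where z: "tag p \<noteq> Added" "node_at G (orig p) = Some (NWit (Wire z))" "x = ren (tag p) z"
      using W pq(1) by blast
    obtain z' where z': "tag q \<noteq> Added" "node_at G (orig q) = Some (NWit (Wire z'))" "x = ren (tag q) z'"
      using W pq(2) by blast
    have "tag p = tag q \<and> z = z'"
      using ren_inj[OF lab(1)[OF pq(1)] lab(1)[OF pq(2)] z(1) z'(1)] z z' by (auto simp: is_wire_def)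
    moreover from this have "orig p = orig q" using z z' typed unfolding typed_forest_def by blast
    ultimately show ?thesis using label_inj pq by (auto simp: prod_eq_iff nodes_def)
  qed
  have uniqD: "p = q" if pq: "node_at reduct p = Some (NWit (DWire x))" "node_at reduct q = Some (NWit (DWire x))" for x p q
  proof -
    obtain z where z: "tag p \<noteq> Added" "node_at G (orig p) = Some (NWit (DWire z))" "x = ren (tag p) z"
      using DW pq(1) by blast
    obtain z' where z': "tag q \<noteq> Added" "node_at G (orig q) = Some (NWit (DWire z'))" "x = ren (tag q) z'"
      using DW pq(2) by blast
    have "tag p = tag q \<and> z = z'"
      using ren_inj[OF lab(1)[OF pq(1)] lab(1)[OF pq(2)] z(1) z'(1)] z z' by (auto simp: is_wire_def)
    moreover from this have "orig p = orig q" using z z' typed unfolding typed_forest_def by blast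
    ultimately show ?thesis using label_inj pq by (auto simp: prod_eq_iff nodes_def)
  qed
  have same: "(k, q) \<in> valid" if "(k, p) \<in> valid" "k \<noteq> Added" "axiom_link G p q \<or> axiom_link G q p" for k p q
  proof -
    have q: "q \<in> nodes G" using that(3) by (auto simp: axiom_link_def nodes_def)
    have "p \<noteq> cut_pos" "p \<noteq> sum_pos" "q \<noteq> cut_pos" "q \<noteq> sum_pos"
      using that(3) node_at_cut node_at_sum by (auto simp: axiom_link_def)
    moreover have "p \<in> H \<longleftrightarrow> q \<in> H" using H_axiom that(3) by blast
    ultimately have "p \<in> doubled \<longleftrightarrow> q \<in> doubled" by (simp add: doubled_def)
    then show ?thesis using that q by (cases k) (auto simp: valid_simps)
  qed
  have "(\<exists>p. node_at reduct p = Some (NWit (Wire x))) \<longleftrightarrow> (\<exists>p. node_at reduct p = Some (NWit (DWire x)))" for x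
  proof
    assume "\<exists>p. node_at reduct p = Some (NWit (Wire x))"
    then obtain p where p: "node_at reduct p = Some (NWit (Wire x))" by blast
    obtain z where z: "tag p \<noteq> Added" "node_at G (orig p) = Some (NWit (Wire z))" "x = ren (tag p) z"
      using W p by blast
    obtain q where q: "node_at G q = Some (NWit (DWire z))"
      using typed z(2) unfolding typed_forest_def by blast
    have v: "(tag p, q) \<in> valid"
      using same[OF lab(1)[OF p] z(1), of q] q z(2) by (auto simp: axiom_link_def)
    then obtain q' where q': "q' \<in> nodes reduct" "label q' = (tag p, q)" using label_surj by blast
    have "contents (tag p, q) = NWit (DWire x)" using wire_contents(2)[OF v] z q by auto
    then show "\<exists>p. node_at reduct p = Some (NWit (DWire x))" using node_at_reduct[OF q'(1)] q'(2) by auto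
  next
    assume "\<exists>p. node_at reduct p = Some (NWit (DWire x))"
    then obtain p where p: "node_at reduct p = Some (NWit (DWire x))" by blast
    obtain z where z: "tag p \<noteq> Added" "node_at G (orig p) = Some (NWit (DWire z))" "x = ren (tag p) z"
      using DW p by blast
    obtain q where q: "node_at G q = Some (NWit (Wire z))"
      using typed z(2) unfolding typed_forest_def by blast
    have v: "(tag p, q) \<in> valid"
      using same[OF lab(1)[OF p] z(1), of q] q z(2) by (auto simp: axiom_link_def)
    then obtain q' where q': "q' \<in> nodes reduct" "label q' = (tag p, q)" using label_surj by blast
    have "contents (tag p, q) = NWit (Wire x)" using wire_contents(1)[OF v] z q by auto
    then show "\<exists>p. node_at reduct p = Some (NWit (Wire x))" using node_at_reduct[OF q'(1)] q'(2) by auto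
  qed
  then show ?thesis unfolding typed_forest_def using typed' uniqW uniqD by blast
qed

section \<open>The type of the reduced forest\<close>

definition closure_of :: "'a type \<Rightarrow> 'a type \<Rightarrow> bool" where
  "closure_of X Y \<longleftrightarrow> X = Y \<or> (\<exists>P. Y = WitT P \<and> X = FormT (underlying P))"

text \<open>
  Duplicated cuts contribute no type and each remaining member of \<open>F\<close> yields one member, so the types
  correspond in order, and a type changes only for a witness that becomes an expansion.
\<close>

lemma closure_reduct: "is_closure (forest_type reduct) (forest_type G)"
proof -
  have m: "list_all2 closure_of (concat (map member_type (dup_member l r D i m))) (member_type m)" for i m
    by (cases m) (auto simp: closure_of_def)
  have "list_all2 closure_of
      (concat (map (\<lambda>i. concat (map member_type (dup_member l r D i (F ! i)))) [0..<length F]))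
      (concat (map (\<lambda>i. member_type (F ! i)) [0..<length F]))"
    by (rule concat_transfer[THEN rel_funD]) (simp add: list.rel_map list.rel_refl_strong m)
  moreover have "forest_type G = concat (map (\<lambda>i. member_type (F ! i)) [0..<length F])"
  proof -
    have "map member_type F = map (\<lambda>i. member_type (F ! i)) [0..<length F]"
      by (rule nth_equalityI) auto
    then show ?thesis by (simp add: forest_type_def G_eq)
  qed
  moreover have "forest_type reduct =
      concat (map (\<lambda>i. concat (map member_type (dup_member l r D i (F ! i)))) [0..<length F])"
  proof -
    have "concat (map member_type (concat (map g xs))) =
        concat (map (\<lambda>i. concat (map member_type (g i))) xs)"
      for g :: "nat \<Rightarrow> ('v, 'a) forest" and xs
      by (induction xs) auto
    then show ?thesis by (simp add: forest_type_def reduct_def dup_forest_eq)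
  qed
  ultimately have "list_all2 closure_of (forest_type reduct) (forest_type G)" by simp
  then show ?thesis
    unfolding is_closure_def
    by (intro exI[of _ id]) (auto simp: list_all2_conv_all_nth closure_of_def)
qed

end

theorem proposition58:
  fixes F G G' :: "('v, 'a) forest"
    and ws ws1 ws2 :: "'v wit list"
    and t :: "'v tree"
    and H D :: "position set"
    and t_pos :: position
    and l r :: "'v \<Rightarrow> 'v"
  assumes G_def: "G = F @ [Cut (Expansion ws) t]"
    and typed: "typed_forest G"
    and AC: "AC_correct G"
    and nontrivial: "length ws \<ge> 2"
    and partition: "mset ws = mset ws1 + mset ws2" "ws1 \<noteq> []" "ws2 \<noteq> []"
    and t_pos_def: "t_pos = [length F, 1]"
    and subnet: "subnet G H"
    and t_root: "t_pos \<in> roots G H"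
    and D_def: "D = roots G H - {t_pos}"
    and other_roots: "\<forall>p\<in>D. (\<exists>w. node_at G p = Some (NWit w)) \<or> (\<exists>u v. node_at G p = Some (NCut u v))"
    and fresh: "fresh_copies l r (wires_in G H) (wires_in G (nodes G))"
    and G'_def: "G' = dup_forest l r D F @
      [Cut (Expansion ws1) (map_tree l t), Cut (Expansion ws2) (map_tree r t)]"
  shows "typed_forest G' \<and> AC_correct G' \<and> is_closure (forest_type G') (forest_type G)"
proof -
  have "image_mset (nth ws) (mset [0..<length ws]) = mset (ws1 @ ws2)"
    using partition(1) by (metis mset_append mset_map map_nth)
  then obtain ix where ix: "mset ix = mset [0..<length ws]" "map (nth ws) ix = ws1 @ ws2"
    using mset_map_eq by blast
  define ix1 ix2 where "ix1 = take (length ws1) ix" and "ix2 = drop (length ws1) ix"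
  have m: "map (nth ws) ix1 = ws1" "map (nth ws) ix2 = ws2"
    using ix(2) by (simp_all add: ix1_def ix2_def take_map[symmetric] drop_map[symmetric])
  have dist: "distinct ix"
    using mset_eq_imp_distinct_iff[OF ix(1)] by simp
  have set: "set ix = {..<length ws}"
    using mset_eq_setD[OF ix(1)] by (simp add: lessThan_atLeast0)
  have ix12: "ix1 @ ix2 = ix" by (simp add: ix1_def ix2_def)
  interpret cut_duplication F G ws t H D l r ix1 ix2
  proof
    show "(\<exists>w. node_at G p = Some (NWit w)) \<or> (\<exists>u v. node_at G p = Some (NCut u v))"
      if "p \<in> D" for p
      using other_roots that by blast
    show "distinct (ix1 @ ix2)" "set (ix1 @ ix2) = {..<length ws}"
      unfolding ix12 by (fact dist, fact set)
    show "[length F, 1] \<in> roots G H" "D = roots G H - {[length F, 1]}"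
      using t_root D_def unfolding t_pos_def .
  qed (fact G_def typed subnet fresh)+
  have "G' = reduct" by (simp add: G'_def reduct_def m)
  moreover have "ix1 \<noteq> []" "ix2 \<noteq> []" using m partition(2,3) by auto
  ultimately show ?thesis using typed_reduct AC_reduct[OF AC] closure_reduct by simp
qed

end
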